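(* Let $(\tilde{R}_3,\rho)$ be the six-element symmetric quandle described in the context. Then: (i) $H_2^{Q,\rho}(\tilde{R}_3,\mathbb{Z})=0$ and $H_3^{Q,\rho}(\tilde{R}_3,\mathbb{Z})\cong\mathbb{Z}$. (ii) The $3$-chain $c=(2,1,2)+(2,0,1)-(1,0,2)-(0,2,1)\in C_3^{Q,\rho}(\tilde{R}_3,\mathbb{Z})$ is a $3$-cycle that represents a generator $[c]$ of $H_3^{Q,\rho}(\tilde{R}_3,\mathbb{Z})\cong\mathbb{Z}$. (iii) Any $3$-cycle in $C_3^{Q,\rho}(\tilde{R}_3,\mathbb{Z})$ with fewer than $4$ basis terms (i.e. represented by a $\mathbb{Z}$-linear combination of fewer than $4$ triples) is null-homologous. (iv) The $3$-cochain $\phi=A(0,1,0)+A(0,1,2)-A(0,2,1)$ is a $3$-cocycle in $Z^3_{Q,\rho}(\tilde{R}_3,\mathbb{Z})$ that represents a generator of $H^3_{Q,\rho}(\tilde{R}_3,\mathbb{Z})\cong\mathbb{Z}$ dual to $[c]$, that is, $\phi([c])=1$. (v) The $3$-cochain $$\phi'=A(0,1,0)+A(0,1,2)+A(0,2,0)-A(0,2,1)+A(1,0,1)-A(1,0,2)+A(1,2,0)+A(1,2,1)+A(2,0,1)+A(2,0,2)-A(2,1,0)+A(2,1,2)$$ is a $3$-cocycle with $\pm$ monic terms such that $\phi'([c])=4$.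
   Context: The quandle. $\tilde{R}_3=\{0,1,2,3,4,5\}$ with operation $x\triangleleft y$ given by the following rows (row $x$ lists $x\triangleleft 0,x\triangleleft 1,\dots,x\triangleleft 5$): row 0: $0,5,1,0,2,4$; row 1: $2,1,3,5,1,0$; row 2: $4,0,2,1,3,2$; row 3: $3,2,4,3,5,1$; row 4: $5,4,0,2,4,3$; row 5: $1,3,5,4,0,5$. This is a quandle ($x\triangleleft x=x$, each $x\mapsto x\triangleleft y$ is bijective, and $(x\triangleleft y)\triangleleft z=(x\triangleleft z)\triangleleft(y\triangleleft z)$), and the involution $\rho=(0\ 3)(1\ 4)(2\ 5)$ is a good involution, i.e. $\rho(x\triangleleft y)=\rho(x)\triangleleft y$ and $(x\triangleleft y)\triangleleft\rho(y)=x$. Symmetric quandle homology. For a symmetric quandle $(X,\rho)$ and $n\ge 1$ let $C_n(X)$ be the free abelian group on $X^n$, and $C_n(X)=0$ for $n\le 0$. The boundary $\partial_n:C_n(X)\to C_{n-1}(X)$ is $$\partial_n(x_1,\dots,x_n)=\sum_{i=1}^n(-1)^i\big[(x_1,\dots,x_{i-1},x_{i+1},\dots,x_n)-(x_1\triangleleft x_i,\dots,x_{i-1}\triangleleft x_i,x_{i+1},\dots,x_n)\big].$$ Let $D_n^Q(X)$ be the subgroup generated by the tuples with $x_i=x_{i+1}$ for some $i$, and $D_n^\rho(X)$ the subgroup generated by all elements $(x_1,\dots,x_n)+(x_1\triangleleft x_i,\dots,x_{i-1}\triangleleft x_i,\rho(x_i),x_{i+1},\dots,x_n)$ with $1\le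 i\le n$. These are subcomplexes. Put $C_n^{Q,\rho}(X,\mathbb{Z})=C_n(X)/(D_n^Q(X)+D_n^\rho(X))$, with homology $H_n^{Q,\rho}(X,\mathbb{Z})$. Cochains are $C^n_{Q,\rho}(X,\mathbb{Z})=\mathrm{Hom}(C_n^{Q,\rho}(X,\mathbb{Z}),\mathbb{Z})$, with cocycles $Z^n_{Q,\rho}$ and cohomology $H^n_{Q,\rho}$; equivalently, cochains are homomorphisms $C_n(X)\to\mathbb{Z}$ vanishing on $D_n^Q(X)+D_n^\rho(X)$. The cochains $A(x,y,z)$. Let $\chi_{(x,y,z)}:\mathbb{Z}(X^3)\to\mathbb{Z}$ denote the characteristic function of the triple $(x,y,z)$, extended linearly, where $X=\tilde{R}_3$. Put $$A(x,y,z)=\chi_{(x,y,z)}-\chi_{(\rho(x),y,z)}-\chi_{(x\triangleleft y,\rho(y),z)}-\chi_{(x\triangleleft z,y\triangleleft z,\rho(z))}+\chi_{(\rho(x)\triangleleft y,\rho(y),z)}+\chi_{(\rho(x)\triangleleft z,y\triangleleft z,\rho(z))}+\chi_{((x\triangleleft y)\triangleleft z,\rho(y)\triangleleft z,\rho(z))}-\chi_{((\rho(x)\triangleleft y)\triangleleft z,\rho(y)\triangleleft z,\rho(z))}.$$ A symmetric quandle $3$-cocycle $\theta$ is said to have $\pm$ monic terms if $\theta(a,b,c)=\pm1$ for every $(a,b,c)\in X^3$ with $a\notin\{b,\rho(b)\}$ and $c\notin\{b,\rho(b)\}$. *)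

theory Defs
  imports "HOL-Algebra.Free_Abelian_Groups"
begin

section \<open>Symmetric quandles\<close>

record 'a sym_quandle = "'a partial_object" +
  tri :: "'a \<Rightarrow> 'a \<Rightarrow> 'a" (infixl \<open>\<triangleleft>\<index>\<close> 70)
  rho :: "'a \<Rightarrow> 'a" (\<open>\<rho>\<index>\<close>)

locale symmetric_quandle =
  fixes Q :: "('a, 'b) sym_quandle_scheme" (structure)
  assumes tri_closed: "x \<in> carrier Q \<Longrightarrow> y \<in> carrier Q \<Longrightarrow> x \<triangleleft> y \<in> carrier Q"
    and tri_idem: "x \<in> carrier Q \<Longrightarrow> x \<triangleleft> x = x"
    and tri_bij: "y \<in> carrier Q \<Longrightarrow> bij_betw (\<lambda>x. x \<triangleleft> y) (carrier Q) (carrier Q)"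
    and tri_distrib: "x \<in> carrier Q \<Longrightarrow> y \<in> carrier Q \<Longrightarrow> z \<in> carrier Q \<Longrightarrow>
      (x \<triangleleft> y) \<triangleleft> z = (x \<triangleleft> z) \<triangleleft> (y \<triangleleft> z)"
    and rho_closed: "x \<in> carrier Q \<Longrightarrow> \<rho> x \<in> carrier Q"
    and rho_invol: "x \<in> carrier Q \<Longrightarrow> \<rho> (\<rho> x) = x"
    and rho_tri: "x \<in> carrier Q \<Longrightarrow> y \<in> carrier Q \<Longrightarrow> \<rho> (x \<triangleleft> y) = \<rho> x \<triangleleft> y"
    and tri_rho: "x \<in> carrier Q \<Longrightarrow> y \<in> carrier Q \<Longrightarrow> (x \<triangleleft> y) \<triangleleft> \<rho> y = x"


section \<open>The chain complex of a symmetric quandle\<close>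

text \<open>An \<open>n\<close>-tuple is a list of length \<open>n\<close>, so positions are counted from \<open>0\<close>. There are no basis
  tuples in degree \<open>0\<close>, because \<open>C\<^sub>0 = 0\<close>; the empty tuple is excluded.\<close>

definition tuples :: "('a, 'b) sym_quandle_scheme \<Rightarrow> nat \<Rightarrow> 'a list set" where
  "tuples Q n = {xs. length xs = n \<and> set xs \<subseteq> carrier Q \<and> n \<noteq> 0}"

definition chain_grp :: "('a, 'b) sym_quandle_scheme \<Rightarrow> nat \<Rightarrow> ('a list \<Rightarrow>\<^sub>0 int) monoid" where
  "chain_grp Q n = free_Abelian_group (tuples Q n)"

definition act_before :: "('a, 'b) sym_quandle_scheme \<Rightarrow> nat \<Rightarrow> 'a list \<Rightarrow> 'a list" where
  "act_before Q i xs = map (\<lambda>y. y \<triangleleft>\<^bsub>Q\<^esub> (xs ! i)) (take i xs)"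

text \<open>The sign is \<open>(-1)\<^sup>i\<close> for the position \<open>i\<close> counted from \<open>1\<close>. In degree \<open>1\<close> the two terms cancel,
  so the boundary of a \<open>1\<close>-chain is \<open>0\<close>.\<close>

definition chain_bd ::
    "('a, 'b) sym_quandle_scheme \<Rightarrow> ('a list \<Rightarrow>\<^sub>0 int) \<Rightarrow> ('a list \<Rightarrow>\<^sub>0 int)" where
  "chain_bd Q = frag_extend (\<lambda>xs. \<Sum>i<length xs. frag_cmul ((-1) ^ Suc i)
     (frag_of (take i xs @ drop (Suc i) xs) - frag_of (act_before Q i xs @ drop (Suc i) xs)))"

definition degenerate_Q ::
    "('a, 'b) sym_quandle_scheme \<Rightarrow> nat \<Rightarrow> ('a list \<Rightarrow>\<^sub>0 int) set" where
  "degenerate_Q Q n = generate (chain_grp Q n)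
     {frag_of xs |xs. xs \<in> tuples Q n \<and> (\<exists>i. Suc i < n \<and> xs ! i = xs ! Suc i)}"

definition degenerate_rho ::
    "('a, 'b) sym_quandle_scheme \<Rightarrow> nat \<Rightarrow> ('a list \<Rightarrow>\<^sub>0 int) set" where
  "degenerate_rho Q n = generate (chain_grp Q n)
     {frag_of xs + frag_of (act_before Q i xs @ \<rho>\<^bsub>Q\<^esub> (xs ! i) # drop (Suc i) xs) |xs i.
        xs \<in> tuples Q n \<and> i < n}"

definition degenerate ::
    "('a, 'b) sym_quandle_scheme \<Rightarrow> nat \<Rightarrow> ('a list \<Rightarrow>\<^sub>0 int) set" where
  "degenerate Q n = degenerate_Q Q n <#>\<^bsub>chain_grp Q n\<^esub> degenerate_rho Q n"


section \<open>Homology\<close>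

definition qchain_grp ::
    "('a, 'b) sym_quandle_scheme \<Rightarrow> nat \<Rightarrow> ('a list \<Rightarrow>\<^sub>0 int) set monoid" where
  "qchain_grp Q n = chain_grp Q n Mod degenerate Q n"

definition qchain ::
    "('a, 'b) sym_quandle_scheme \<Rightarrow> nat \<Rightarrow> ('a list \<Rightarrow>\<^sub>0 int) \<Rightarrow> ('a list \<Rightarrow>\<^sub>0 int) set" where
  "qchain Q n c = degenerate Q n #>\<^bsub>chain_grp Q n\<^esub> c"

text \<open>The map induced by the boundary on cosets, from degree \<open>n\<close> to degree \<open>n - 1\<close>. As the
  degenerate chains form a subcomplex, the image set in the definition is a singleton. The
  truncation \<open>0 - 1 = 0\<close> is harmless, as the group in degree \<open>0\<close> is trivial.\<close>

definition qchain_bd :: "('a, 'b) sym_quandle_scheme \<Rightarrow> nat \<Rightarrow>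
    ('a list \<Rightarrow>\<^sub>0 int) set \<Rightarrow> ('a list \<Rightarrow>\<^sub>0 int) set" where
  "qchain_bd Q n K = the_elem ((\<lambda>c. qchain Q (n - 1) (chain_bd Q c)) ` K)"

definition cycles ::
    "('a, 'b) sym_quandle_scheme \<Rightarrow> nat \<Rightarrow> ('a list \<Rightarrow>\<^sub>0 int) set set" where
  "cycles Q n = kernel (qchain_grp Q n) (qchain_grp Q (n - 1)) (qchain_bd Q n)"

definition boundaries ::
    "('a, 'b) sym_quandle_scheme \<Rightarrow> nat \<Rightarrow> ('a list \<Rightarrow>\<^sub>0 int) set set" where
  "boundaries Q n = qchain_bd Q (Suc n) ` carrier (qchain_grp Q (Suc n))"

definition homology_grp ::
    "('a, 'b) sym_quandle_scheme \<Rightarrow> nat \<Rightarrow> ('a list \<Rightarrow>\<^sub>0 int) set set monoid" where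
  "homology_grp Q n = (qchain_grp Q n)\<lparr>carrier := cycles Q n\<rparr> Mod boundaries Q n"

definition homology_class :: "('a, 'b) sym_quandle_scheme \<Rightarrow> nat \<Rightarrow>
    ('a list \<Rightarrow>\<^sub>0 int) set \<Rightarrow> ('a list \<Rightarrow>\<^sub>0 int) set set" where
  "homology_class Q n z = boundaries Q n #>\<^bsub>qchain_grp Q n\<^esub> z"


section \<open>Cohomology\<close>

text \<open>Since \<^const>\<open>hom\<close> does not constrain the values outside the carrier, homomorphisms are made
  extensional, so that each is represented by exactly one function.\<close>

definition hom_int_grp :: "('g, 'm) monoid_scheme \<Rightarrow> ('g \<Rightarrow> int) monoid" where
  "hom_int_grp G =
     \<lparr>carrier = hom G integer_group \<inter> extensional (carrier G),
      monoid.mult = (\<lambda>f g. \<lambda>x\<in>carrier G. f x + g x),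
      one = (\<lambda>x\<in>carrier G. 0)\<rparr>"

definition cochain_grp ::
    "('a, 'b) sym_quandle_scheme \<Rightarrow> nat \<Rightarrow> (('a list \<Rightarrow>\<^sub>0 int) set \<Rightarrow> int) monoid" where
  "cochain_grp Q n = hom_int_grp (qchain_grp Q n)"

text \<open>The dual of the boundary in degree \<open>n\<close>, hence a map from \<open>(n - 1)\<close>-cochains to
  \<open>n\<close>-cochains.\<close>

definition cobd :: "('a, 'b) sym_quandle_scheme \<Rightarrow> nat \<Rightarrow>
    (('a list \<Rightarrow>\<^sub>0 int) set \<Rightarrow> int) \<Rightarrow> (('a list \<Rightarrow>\<^sub>0 int) set \<Rightarrow> int)" where
  "cobd Q n f = (\<lambda>K\<in>carrier (qchain_grp Q n). f (qchain_bd Q n K))"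

definition cocycles ::
    "('a, 'b) sym_quandle_scheme \<Rightarrow> nat \<Rightarrow> (('a list \<Rightarrow>\<^sub>0 int) set \<Rightarrow> int) set" where
  "cocycles Q n = kernel (cochain_grp Q n) (cochain_grp Q (Suc n)) (cobd Q (Suc n))"

definition coboundaries ::
    "('a, 'b) sym_quandle_scheme \<Rightarrow> nat \<Rightarrow> (('a list \<Rightarrow>\<^sub>0 int) set \<Rightarrow> int) set" where
  "coboundaries Q n = cobd Q n ` carrier (cochain_grp Q (n - 1))"

definition cohomology_grp ::
    "('a, 'b) sym_quandle_scheme \<Rightarrow> nat \<Rightarrow> (('a list \<Rightarrow>\<^sub>0 int) set \<Rightarrow> int) set monoid" where
  "cohomology_grp Q n = (cochain_grp Q n)\<lparr>carrier := cocycles Q n\<rparr> Mod coboundaries Q n"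

definition cohomology_class :: "('a, 'b) sym_quandle_scheme \<Rightarrow> nat \<Rightarrow>
    (('a list \<Rightarrow>\<^sub>0 int) set \<Rightarrow> int) \<Rightarrow> (('a list \<Rightarrow>\<^sub>0 int) set \<Rightarrow> int) set" where
  "cohomology_class Q n f = coboundaries Q n #>\<^bsub>cochain_grp Q n\<^esub> f"

text \<open>A homomorphism on the free group that vanishes on the degenerate chains is constant on each
  coset, and so induces a cochain.\<close>

definition induced_cochain :: "('a, 'b) sym_quandle_scheme \<Rightarrow> nat \<Rightarrow>
    (('a list \<Rightarrow>\<^sub>0 int) \<Rightarrow> int) \<Rightarrow> (('a list \<Rightarrow>\<^sub>0 int) set \<Rightarrow> int)" where
  "induced_cochain Q n \<theta> = (\<lambda>K\<in>carrier (qchain_grp Q n). the_elem (\<theta> ` K))"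

definition is_cocycle ::
    "('a, 'b) sym_quandle_scheme \<Rightarrow> nat \<Rightarrow> (('a list \<Rightarrow>\<^sub>0 int) \<Rightarrow> int) \<Rightarrow> bool" where
  "is_cocycle Q n \<theta> \<longleftrightarrow> \<theta> \<in> hom (chain_grp Q n) integer_group \<and>
     (\<forall>d\<in>degenerate Q n. \<theta> d = 0) \<and> induced_cochain Q n \<theta> \<in> cocycles Q n"

text \<open>The value of a cocycle on a homology class, that is, its common value on the cycles in the
  class.\<close>

definition eval_class ::
    "(('a list \<Rightarrow>\<^sub>0 int) set \<Rightarrow> int) \<Rightarrow> ('a list \<Rightarrow>\<^sub>0 int) set set \<Rightarrow> int" where
  "eval_class f h = the_elem (f ` h)"

definition pm_monic ::
    "('a, 'b) sym_quandle_scheme \<Rightarrow> (('a list \<Rightarrow>\<^sub>0 int) \<Rightarrow> int) \<Rightarrow> bool" where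
  "pm_monic Q \<theta> \<longleftrightarrow> (\<forall>a\<in>carrier Q. \<forall>b\<in>carrier Q. \<forall>c\<in>carrier Q.
     a \<notin> {b, \<rho>\<^bsub>Q\<^esub> b} \<and> c \<notin> {b, \<rho>\<^bsub>Q\<^esub> b} \<longrightarrow> \<theta> (frag_of [a, b, c]) \<in> {1, -1})"


section \<open>The quandle with six elements\<close>

definition R3 :: "nat sym_quandle" where
  "R3 = \<lparr>carrier = {0, 1, 2, 3, 4, 5},
         tri = (\<lambda>x y. [[0, 5, 1, 0, 2, 4],
                       [2, 1, 3, 5, 1, 0],
                       [4, 0, 2, 1, 3, 2],
                       [3, 2, 4, 3, 5, 1],
                       [5, 4, 0, 2, 4, 3],
                       [1, 3, 5, 4, 0, 5]] ! x ! y),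
         rho = (\<lambda>x. [3, 4, 5, 0, 1, 2] ! x)\<rparr>"

lemma symmetric_quandle_R3: "symmetric_quandle R3"
proof -
  let ?X = "[0, 1, 2, 3, 4, 5] :: nat list"
  have X: "carrier R3 = set ?X"
    by (simp add: R3_def)
  have 1: "\<forall>x\<in>set ?X. \<forall>y\<in>set ?X. \<forall>z\<in>set ?X.
      tri R3 (tri R3 x y) z = tri R3 (tri R3 x z) (tri R3 y z)"
    unfolding R3_def by code_simp
  have 2: "\<forall>x\<in>set ?X. tri R3 x x = x \<and> rho R3 x \<in> set ?X \<and> rho R3 (rho R3 x) = x"
    unfolding R3_def by code_simp
  have 3: "\<forall>x\<in>set ?X. \<forall>y\<in>set ?X. tri R3 x y \<in> set ?X \<and>
      rho R3 (tri R3 x y) = tri R3 (rho R3 x) y \<and> tri R3 (tri R3 x y) (rho R3 y) = x"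
    unfolding R3_def by code_simp
  have 4: "bij_betw (\<lambda>x. tri R3 x y) (set ?X) (set ?X)" if y: "y \<in> set ?X" for y
  proof (rule bij_betwI [where g = "\<lambda>x. tri R3 x (rho R3 y)"])
    show "tri R3 (tri R3 x y) (rho R3 y) = x" if "x \<in> set ?X" for x
      using 3 that y by blast
    show "tri R3 (tri R3 x (rho R3 y)) y = x" if "x \<in> set ?X" for x
      using 2 3 that y by metis
  qed (use 2 3 y in blast)+
  show ?thesis
    unfolding symmetric_quandle_def X using 1 2 3 4 by blast
qed

definition chi :: "'a list \<Rightarrow> ('a list \<Rightarrow>\<^sub>0 int) \<Rightarrow> int" where
  "chi xs c = Poly_Mapping.lookup c xs"

definition A :: "nat \<Rightarrow> nat \<Rightarrow> nat \<Rightarrow> (nat list \<Rightarrow>\<^sub>0 int) \<Rightarrow> int" where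
  "A x y z c = (let r = rho R3; t = tri R3 in
       chi [x, y, z] c
     - chi [r x, y, z] c
     - chi [t x y, r y, z] c
     - chi [t x z, t y z, r z] c
     + chi [t (r x) y, r y, z] c
     + chi [t (r x) z, t y z, r z] c
     + chi [t (t x y) z, t (r y) z, r z] c
     - chi [t (t (r x) y) z, t (r y) z, r z] c)"

definition cyc :: "nat list \<Rightarrow>\<^sub>0 int" where
  "cyc = frag_of [2, 1, 2] + frag_of [2, 0, 1] - frag_of [1, 0, 2] - frag_of [0, 2, 1]"

definition phi :: "(nat list \<Rightarrow>\<^sub>0 int) \<Rightarrow> int" where
  "phi c = A 0 1 0 c + A 0 1 2 c - A 0 2 1 c"

definition phi' :: "(nat list \<Rightarrow>\<^sub>0 int) \<Rightarrow> int" where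
  "phi' c = A 0 1 0 c + A 0 1 2 c + A 0 2 0 c - A 0 2 1 c + A 1 0 1 c - A 1 0 2 c
          + A 1 2 0 c + A 1 2 1 c + A 2 0 1 c + A 2 0 2 c - A 2 1 0 c + A 2 1 2 c"

end

theory Submission
  imports Defs
begin

text \<open>Modulo degenerate chains every chain is a combination of the tuples over \<open>{0, 1, 2}\<close> without equal
  neighbours, and the signed indicator functions of their orbits are the dual coordinates; the cochain
  \<open>A(x,y,z)\<close> is the coordinate of \<open>(x,y,z)\<close>. The twelve coordinates in degree \<open>3\<close> fall into four groups
  of three, whose signed sums \<open>\<phi>\<^sub>0 = \<phi>\<close>, \<open>\<phi>\<^sub>1\<close>, \<open>\<phi>\<^sub>2\<close>, \<open>\<phi>\<^sub>3\<close> are cohomologous cocycles with disjoint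
  supports and \<open>\<phi>' = \<phi>\<^sub>0 + \<phi>\<^sub>1 + \<phi>\<^sub>2 + \<phi>\<^sub>3\<close>. The cycle \<open>c\<close> has one term in each group, and every chain \<open>z\<close> equals
  the combination of these four terms with coefficients \<open>\<phi>\<^sub>i(z)\<close>, up to a boundary. Thus a cycle \<open>z\<close> is
  homologous to \<open>\<phi>(z) c\<close>, and if \<open>\<phi>(z) \<noteq> 0\<close> then \<open>z\<close> involves a triple from each of the four disjoint
  supports.\<close>

section \<open>The boundary in terms of the last entry\<close>

text \<open>The number four is a rank. Modulo degenerate chains the groups in degrees 1 to 4 are
  free of rank 3, 6, 12 and 24, and the boundary has rank 3, 3 and 8 on degrees 2, 3 and 4. Hence
  3-chains modulo boundaries have rank 12 - 8 = 4. This quotient is free: the signed terms of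
  \<open>cyc\<close> are a basis and the four signed sums are the dual basis. The boundary kills
  exactly the diagonal, which gives the homology in degree 3; dually, all integer functionals on the
  quotient are cocycles, and modulo the differences of the four dual vectors they form an infinite
  cyclic group. In degree 2 the analogous quotient has rank 3 and the boundary is injective on it,
  with determinant 2 up to sign.

  A free quotient has a short certificate: functionals that vanish on boundaries, and for each tuple
  an explicit chain whose boundary reduces it to the basis. The obstacle is that both are statements
  modulo degenerate chains, where a relation flips one entry and at the same time acts on all
  entries before it. The coordinates turn membership in this subgroup into finitely many integer
  equations, which are then evaluated.\<close>

definition act_list :: "('a, 'b) sym_quandle_scheme \<Rightarrow> 'a \<Rightarrow> 'a list \<Rightarrow> 'a list" where
  "act_list Q x ys = map (\<lambda>y. y \<triangleleft>\<^bsub>Q\<^esub> x) ys"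

definition act_chain ::
    "('a, 'b) sym_quandle_scheme \<Rightarrow> 'a \<Rightarrow> ('a list \<Rightarrow>\<^sub>0 int) \<Rightarrow> ('a list \<Rightarrow>\<^sub>0 int)" where
  "act_chain Q x = frag_extend (\<lambda>ys. frag_of (act_list Q x ys))"

definition snoc_chain :: "'a \<Rightarrow> ('a list \<Rightarrow>\<^sub>0 int) \<Rightarrow> ('a list \<Rightarrow>\<^sub>0 int)" where
  "snoc_chain x = frag_extend (\<lambda>ys. frag_of (ys @ [x]))"

lemma act_list_simps [simp]:
  "act_list Q x [] = []"
  "act_list Q x (y # ys) = (y \<triangleleft>\<^bsub>Q\<^esub> x) # act_list Q x ys"
  "act_list Q x (ys @ zs) = act_list Q x ys @ act_list Q x zs"
  "length (act_list Q x ys) = length ys"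
  by (simp_all add: act_list_def)

lemma act_chain_simps [simp]:
  "act_chain Q x 0 = 0"
  "act_chain Q x (frag_of ys) = frag_of (act_list Q x ys)"
  "act_chain Q x (u + v) = act_chain Q x u + act_chain Q x v"
  "act_chain Q x (u - v) = act_chain Q x u - act_chain Q x v"
  "act_chain Q x (frag_cmul k u) = frag_cmul k (act_chain Q x u)"
  by (simp_all add: act_chain_def frag_extend_add frag_extend_diff frag_extend_cmul)

lemma snoc_chain_simps [simp]:
  "snoc_chain x 0 = 0"
  "snoc_chain x (frag_of ys) = frag_of (ys @ [x])"
  "snoc_chain x (u + v) = snoc_chain x u + snoc_chain x v"
  "snoc_chain x (u - v) = snoc_chain x u - snoc_chain x v"
  "snoc_chain x (frag_cmul k u) = frag_cmul k (snoc_chain x u)"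
  by (simp_all add: snoc_chain_def frag_extend_add frag_extend_diff frag_extend_cmul)

lemma chain_bd_simps [simp]:
  "chain_bd Q 0 = 0"
  "chain_bd Q (frag_of []) = 0"
  "chain_bd Q (u + v) = chain_bd Q u + chain_bd Q v"
  "chain_bd Q (u - v) = chain_bd Q u - chain_bd Q v"
  "chain_bd Q (frag_cmul k u) = frag_cmul k (chain_bd Q u)"
  by (simp_all add: chain_bd_def frag_extend_add frag_extend_diff frag_extend_cmul)

text \<open>The face at a position alters only that entry and the entries before it, so appending
  \<open>x\<close> on the right commutes with all faces except the new last one. This recursion on
  the last entry carries the inductions on boundaries below.\<close>

lemma chain_bd_snoc:
  "chain_bd Q (frag_of (xs @ [x])) = snoc_chain x (chain_bd Q (frag_of xs))
     + frag_cmul ((-1) ^ Suc (length xs)) (frag_of xs - frag_of (act_list Q x xs))"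
proof -
  have "(\<Sum>i<length xs. frag_cmul ((-1) ^ Suc i)
          (frag_of (take i (xs @ [x]) @ drop (Suc i) (xs @ [x]))
            - frag_of (act_before Q i (xs @ [x]) @ drop (Suc i) (xs @ [x]))))
      = (\<Sum>i<length xs. snoc_chain x (frag_cmul ((-1) ^ Suc i)
          (frag_of (take i xs @ drop (Suc i) xs) - frag_of (act_before Q i xs @ drop (Suc i) xs))))"
    by (intro sum.cong) (auto simp: act_before_def nth_append)
  also have "\<dots> = snoc_chain x (chain_bd Q (frag_of xs))"
    by (simp add: chain_bd_def snoc_chain_def frag_extend_sum o_def)
  finally show ?thesis
    by (simp add: chain_bd_def act_before_def act_list_def)
qed

lemma chain_bd_snoc_chain:
  assumes "Poly_Mapping.keys u \<subseteq> {xs. length xs = n}"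
  shows "chain_bd Q (snoc_chain x u) = snoc_chain x (chain_bd Q u)
     + frag_cmul ((-1) ^ Suc n) (u - act_chain Q x u)"
  using assms
proof (induction u rule: frag_induction)
  case (one xs)
  then show ?case by (simp add: chain_bd_snoc del: power_Suc)
next
  case (diff u v)
  then show ?case by (simp add: frag_cmul_distrib2 algebra_simps del: power_Suc)
     (simp add: algebra_simps flip: frag_cmul_distrib2 )
qed simp

text \<open>Agrees with \<open>tuples\<close> in positive degree but keeps the empty word in degree
  0, so that inductions removing the last entry have a starting point.\<close>

definition words :: "('a, 'b) sym_quandle_scheme \<Rightarrow> nat \<Rightarrow> 'a list set" where
  "words Q n = {xs. length xs = n \<and> set xs \<subseteq> carrier Q}"

lemma tuples_eq_words: "0 < n \<Longrightarrow> tuples Q n = words Q n"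
  by (auto simp: tuples_def words_def)

lemma words_0 [simp]: "words Q 0 = {[]}"
  by (auto simp: words_def)

lemma snoc_in_words [simp]: "xs @ [x] \<in> words Q (Suc n) \<longleftrightarrow> xs \<in> words Q n \<and> x \<in> carrier Q"
  by (auto simp: words_def)

lemma words_SucE:
  assumes "ys \<in> words Q (Suc n)"
  obtains xs x where "ys = xs @ [x]" "xs \<in> words Q n" "x \<in> carrier Q"
  using assms by (cases ys rule: rev_cases) (auto simp: words_def)

lemma carrier_chain_grp [simp]: "c \<in> carrier (chain_grp Q n) \<longleftrightarrow> Poly_Mapping.keys c \<subseteq> tuples Q n"
  and mult_chain_grp [simp]: "a \<otimes>\<^bsub>chain_grp Q n\<^esub> b = a + b"
  and one_chain_grp [simp]: "\<one>\<^bsub>chain_grp Q n\<^esub> = 0"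
  by (simp_all add: chain_grp_def)

lemma keys_diff_subset:
  fixes a b :: "'a \<Rightarrow>\<^sub>0 int"
  shows "Poly_Mapping.keys a \<subseteq> S \<Longrightarrow> Poly_Mapping.keys b \<subseteq> S \<Longrightarrow> Poly_Mapping.keys (a - b) \<subseteq> S"
  using keys_diff[of a b] by blast

lemma keys_add_subset:
  fixes a b :: "'a \<Rightarrow>\<^sub>0 int"
  shows "Poly_Mapping.keys a \<subseteq> S \<Longrightarrow> Poly_Mapping.keys b \<subseteq> S \<Longrightarrow> Poly_Mapping.keys (a + b) \<subseteq> S"
  using keys_add[of a b] by blast

lemma comm_group_chain_grp: "comm_group (chain_grp Q n)"
  by (simp add: chain_grp_def abelian_free_Abelian_group)

lemma inv_chain_grp: "Poly_Mapping.keys c \<subseteq> tuples Q n \<Longrightarrow> inv\<^bsub>chain_grp Q n\<^esub> c = - c"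
  by (simp add: chain_grp_def)

lemma keys_snoc_chain:
  assumes "Poly_Mapping.keys u \<subseteq> words Q n" "x \<in> carrier Q"
  shows "Poly_Mapping.keys (snoc_chain x u) \<subseteq> words Q (Suc n)"
  using assms(1) by (induction u rule: frag_induction) (use assms(2) in \<open>auto dest!: subsetD[OF keys_diff]\<close>)

section \<open>Degenerate chains\<close>

context symmetric_quandle
begin

section \<open>The boundary squares to zero\<close>

lemma words_act_list [intro]: "xs \<in> words Q n \<Longrightarrow> x \<in> carrier Q \<Longrightarrow> act_list Q x xs \<in> words Q n"
  by (auto simp: words_def act_list_def tri_closed)

lemma rho_tri_rho: "x \<in> carrier Q \<Longrightarrow> y \<in> carrier Q \<Longrightarrow> (x \<triangleleft> \<rho> y) \<triangleleft> y = x"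
  using tri_rho[of x "\<rho> y"] by (simp add: rho_closed rho_invol)

lemma act_list_distrib:
  assumes "set ys \<subseteq> carrier Q" "x \<in> carrier Q" "y \<in> carrier Q"
  shows "act_list Q x (act_list Q y ys) = act_list Q (y \<triangleleft> x) (act_list Q x ys)"
  using assms by (auto simp: act_list_def intro!: tri_distrib)

lemma act_list_rho:
  assumes "set ys \<subseteq> carrier Q" "x \<in> carrier Q"
  shows "act_list Q (\<rho> x) (act_list Q x ys) = ys" "act_list Q x (act_list Q (\<rho> x) ys) = ys"
  using assms by (induction ys) (auto simp: tri_rho rho_tri_rho)

lemma act_chain_snoc_chain:
  "act_chain Q x (snoc_chain y u) = snoc_chain (y \<triangleleft> x) (act_chain Q x u)"
proof -
  have "Poly_Mapping.keys u \<subseteq> UNIV" by simp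
  then show ?thesis
    by (induction u rule: frag_induction) auto
qed

text \<open>By self-distributivity the action of \<open>x\<close> is an endomorphism of the quandle,
  hence a chain map.\<close>

lemma chain_bd_act_list:
  assumes "set xs \<subseteq> carrier Q" "x \<in> carrier Q"
  shows "chain_bd Q (frag_of (act_list Q x xs)) = act_chain Q x (chain_bd Q (frag_of xs))"
  using assms
proof (induction xs rule: rev_induct)
  case (snoc y xs)
  then show ?case
    by (simp add: chain_bd_snoc act_chain_snoc_chain act_list_distrib[of xs x y] del: power_Suc)
qed simp

lemma keys_chain_bd_frag_of:
  "xs \<in> words Q (Suc n) \<Longrightarrow> Poly_Mapping.keys (chain_bd Q (frag_of xs)) \<subseteq> words Q n"
proof (induction n arbitrary: xs)
  case 0
  then show ?case by (elim words_SucE) (auto simp: chain_bd_snoc[of _ "[]", simplified])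
next
  case (Suc n)
  from Suc.prems obtain ys x where ys: "xs = ys @ [x]" "ys \<in> words Q (Suc n)" "x \<in> carrier Q"
    by (rule words_SucE)
  have "Poly_Mapping.keys (frag_cmul k (frag_of ys - frag_of (act_list Q x ys)))
      \<subseteq> words Q (Suc n)" for k
    using ys by (intro order.trans[OF keys_cmul] keys_diff_subset) auto
  then show ?case
    using ys Suc.IH[of ys] unfolding ys(1) chain_bd_snoc
    by (intro keys_add_subset keys_snoc_chain) auto
qed

lemma keys_chain_bd:
  assumes "Poly_Mapping.keys u \<subseteq> words Q (Suc n)"
  shows "Poly_Mapping.keys (chain_bd Q u) \<subseteq> words Q n"
  using assms
  by (induction u rule: frag_induction) (auto dest!: subsetD[OF keys_diff] dest: subsetD[OF keys_chain_bd_frag_of])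

text \<open>Apply the recursion on the last entry twice. The part that still ends in
  \<open>x\<close> vanishes by induction; the two parts without \<open>x\<close> carry opposite
  signs and cancel because the action of \<open>x\<close> is a chain map.\<close>

lemma chain_bd_chain_bd_frag_of:
  "set xs \<subseteq> carrier Q \<Longrightarrow> chain_bd Q (chain_bd Q (frag_of xs)) = 0"
proof (induction xs rule: rev_induct)
  case (snoc x xs)
  show ?case
  proof (cases xs rule: rev_cases)
    case Nil
    then show ?thesis by (simp add: chain_bd_snoc[of _ "[]", simplified])
  next
    case (snoc ys y)
    define n where "n = length ys"
    have xs: "xs \<in> words Q (Suc n)" and x: "x \<in> carrier Q"
      using snoc.prems snoc by (auto simp: words_def n_def)
    have len: "length xs = Suc n" using xs by (simp add: words_def)
    have "chain_bd Q (snoc_chain x (chain_bd Q (frag_of xs)))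
        = frag_cmul ((-1) ^ Suc n) (chain_bd Q (frag_of xs) - act_chain Q x (chain_bd Q (frag_of xs)))"
      using keys_chain_bd_frag_of[OF xs] snoc.IH snoc.prems
      by (subst chain_bd_snoc_chain[where n = n]) (auto simp: words_def)
    moreover have "chain_bd Q (frag_of (act_list Q x xs)) = act_chain Q x (chain_bd Q (frag_of xs))"
      using xs x by (intro chain_bd_act_list) (auto simp: words_def)
    ultimately show ?thesis
      by (simp add: chain_bd_snoc len flip: frag_cmul_distrib)
  qed
qed simp

lemma chain_bd_chain_bd:
  assumes "Poly_Mapping.keys u \<subseteq> words Q n"
  shows "chain_bd Q (chain_bd Q u) = 0"
  using assms
  by (induction u rule: frag_induction) (auto simp: words_def chain_bd_chain_bd_frag_of)

section \<open>The degenerate chains form a subcomplex\<close>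

abbreviation gens_Q :: "nat \<Rightarrow> ('a list \<Rightarrow>\<^sub>0 int) set" where
  "gens_Q n \<equiv> {frag_of xs |xs. xs \<in> tuples Q n \<and> (\<exists>i. Suc i < n \<and> xs ! i = xs ! Suc i)}"

abbreviation gens_rho :: "nat \<Rightarrow> ('a list \<Rightarrow>\<^sub>0 int) set" where
  "gens_rho n \<equiv> {frag_of xs + frag_of (act_before Q i xs @ \<rho> (xs ! i) # drop (Suc i) xs) |xs i.
     xs \<in> tuples Q n \<and> i < n}"

lemma gens_Q_subset: "gens_Q n \<subseteq> carrier (chain_grp Q n)"
  by auto

lemma gens_rho_subset: "gens_rho n \<subseteq> carrier (chain_grp Q n)"
proof -
  have "act_before Q i xs @ \<rho> (xs ! i) # drop (Suc i) xs \<in> tuples Q n"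
    if "xs \<in> tuples Q n" "i < n" for xs i
    using that by (auto simp: tuples_def act_before_def intro!: tri_closed rho_closed
        dest!: in_set_takeD in_set_dropD)
  then show ?thesis
    by (auto dest!: subsetD[OF keys_add])
qed

lemma subgroup_degenerate: "subgroup (degenerate Q n) (chain_grp Q n)"
proof -
  interpret comm_group "chain_grp Q n" by (rule comm_group_chain_grp)
  show ?thesis
    unfolding degenerate_def degenerate_Q_def degenerate_rho_def
    by (intro mult_subgroups generate_is_subgroup gens_Q_subset gens_rho_subset)
qed

lemma degenerate_keys: "u \<in> degenerate Q n \<Longrightarrow> Poly_Mapping.keys u \<subseteq> tuples Q n"
  using subgroup.mem_carrier[OF subgroup_degenerate] by fastforce

lemma degenerate_0 [simp]: "0 \<in> degenerate Q n"
  using subgroup.one_closed[OF subgroup_degenerate] by simp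

lemma degenerate_add: "u \<in> degenerate Q n \<Longrightarrow> v \<in> degenerate Q n \<Longrightarrow> u + v \<in> degenerate Q n"
  using subgroup.m_closed[OF subgroup_degenerate] by fastforce

lemma degenerate_uminus: "u \<in> degenerate Q n \<Longrightarrow> - u \<in> degenerate Q n"
  using subgroup.m_inv_closed[OF subgroup_degenerate, of u n] inv_chain_grp[OF degenerate_keys, of u n]
  by simp

lemma degenerate_diff: "u \<in> degenerate Q n \<Longrightarrow> v \<in> degenerate Q n \<Longrightarrow> u - v \<in> degenerate Q n"
  using degenerate_add[of u n "- v"] degenerate_uminus by simp

lemma degenerate_cmul: "u \<in> degenerate Q n \<Longrightarrow> frag_cmul k u \<in> degenerate Q n"
  by (rule frag_closure_minus_cmul) (auto intro: degenerate_diff)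

lemma degenerate_Q_subset: "degenerate_Q Q n \<subseteq> degenerate Q n"
proof
  fix u assume u: "u \<in> degenerate_Q Q n"
  have "0 \<in> degenerate_rho Q n"
    unfolding degenerate_rho_def using generate.one[of "chain_grp Q n"] by simp
  then have "u \<otimes>\<^bsub>chain_grp Q n\<^esub> 0 \<in> degenerate Q n"
    using u unfolding degenerate_def set_mult_def by blast
  then show "u \<in> degenerate Q n" by simp
qed

lemma degenerate_rho_subset: "degenerate_rho Q n \<subseteq> degenerate Q n"
proof
  fix u assume u: "u \<in> degenerate_rho Q n"
  have "0 \<in> degenerate_Q Q n"
    unfolding degenerate_Q_def using generate.one[of "chain_grp Q n"] by simp
  then have "0 \<otimes>\<^bsub>chain_grp Q n\<^esub> u \<in> degenerate Q n"
    using u unfolding degenerate_def set_mult_def by blast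
  then show "u \<in> degenerate Q n" by simp
qed

lemma degenerate_repeat:
  assumes "xs @ x # x # zs \<in> words Q n"
  shows "frag_of (xs @ x # x # zs) \<in> degenerate Q n"
proof -
  have "frag_of (xs @ x # x # zs) \<in> degenerate_Q Q n"
    unfolding degenerate_Q_def
    using assms by (intro generate.incl CollectI exI[of _ "xs @ x # x # zs"])
      (auto simp: tuples_def words_def nth_append intro!: exI[of _ "length xs"])
  then show ?thesis using degenerate_Q_subset by blast
qed

lemma degenerate_flip:
  assumes "xs @ x # zs \<in> words Q n"
  shows "frag_of (xs @ x # zs) + frag_of (act_list Q x xs @ \<rho> x # zs) \<in> degenerate Q n"
proof -
  have "frag_of (xs @ x # zs) + frag_of (act_list Q x xs @ \<rho> x # zs) \<in> degenerate_rho Q n"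
    unfolding degenerate_rho_def
    using assms by (intro generate.incl CollectI exI[of _ "xs @ x # zs"] exI[of _ "length xs"])
      (auto simp: tuples_def words_def nth_append act_before_def act_list_def)
  then show ?thesis using degenerate_rho_subset by blast
qed

text \<open>The generators are restated as splittings \<open>xs @ x # zs\<close> instead of
  positions, so that further inductions can peel entries off the suffix \<open>zs\<close>.\<close>

lemma degenerate_induct [consumes 1, case_names zero add uminus repeat flip]:
  assumes u: "u \<in> degenerate Q n" and zero: "P 0"
    and add: "\<And>a b. P a \<Longrightarrow> P b \<Longrightarrow> P (a + b)" and uminus: "\<And>a. P a \<Longrightarrow> P (- a)"
    and repeat: "\<And>xs x zs. xs @ x # x # zs \<in> words Q n \<Longrightarrow> P (frag_of (xs @ x # x # zs))"
    and flip: "\<And>xs x zs. xs @ x # zs \<in> words Q n \<Longrightarrow>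
      P (frag_of (xs @ x # zs) + frag_of (act_list Q x xs @ \<rho> x # zs))"
  shows "P u"
proof -
  have gen: "P u" if "u \<in> generate (chain_grp Q n) H" "H \<subseteq> carrier (chain_grp Q n)"
    "\<And>h. h \<in> H \<Longrightarrow> P h" for u H
    using that(1)
  proof induction
    case (inv h)
    then show ?case
      using that(2,3) uminus inv_chain_grp[of h Q n] by auto
  qed (auto simp: zero that(3) add)
  have Q: "P h" if h: "h \<in> gens_Q n" for h
  proof -
    obtain xs i where xs: "h = frag_of xs" "xs \<in> tuples Q n" "Suc i < n" "xs ! i = xs ! Suc i"
      using h by auto
    have "xs = take i xs @ xs ! i # xs ! i # drop (Suc (Suc i)) xs"
      using xs id_take_nth_drop[of i xs] Cons_nth_drop_Suc[of "Suc i" xs] by (simp add: tuples_def)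
    moreover have "xs \<in> words Q n"
      using xs by (simp add: tuples_eq_words)
    ultimately show ?thesis
      using repeat[of "take i xs" "xs ! i" "drop (Suc (Suc i)) xs"] xs(1) by simp
  qed
  have rho: "P h" if h: "h \<in> gens_rho n" for h
  proof -
    obtain xs i where xs: "h = frag_of xs + frag_of (act_before Q i xs @ \<rho> (xs ! i) # drop (Suc i) xs)"
      "xs \<in> tuples Q n" "i < n"
      using h by auto
    have "xs = take i xs @ xs ! i # drop (Suc i) xs"
      using xs id_take_nth_drop[of i xs] by (simp add: tuples_def)
    moreover have "xs \<in> words Q n"
      using xs by (simp add: tuples_eq_words)
    ultimately show ?thesis
      using flip[of "take i xs" "xs ! i" "drop (Suc i) xs"] xs(1)
      by (simp add: act_before_def act_list_def)
  qed
  obtain v w where "v \<in> degenerate_Q Q n" "w \<in> degenerate_rho Q n" "u = v + w"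
    using u by (auto simp: degenerate_def set_mult_def)
  then show ?thesis
    using gen[OF _ gens_Q_subset Q] gen[OF _ gens_rho_subset rho] add
    by (simp add: degenerate_Q_def degenerate_rho_def)
qed

lemma snoc_chain_degenerate:
  assumes "u \<in> degenerate Q n" "x \<in> carrier Q"
  shows "snoc_chain x u \<in> degenerate Q (Suc n)"
  using assms(1)
proof (induction u rule: degenerate_induct)
  case (uminus a)
  then show ?case
    using degenerate_uminus[of "snoc_chain x a"] snoc_chain_simps(5)[of x "-1" a] by simp
next
  case (repeat xs y zs)
  then show ?case
    using assms(2) degenerate_repeat[of xs y "zs @ [x]"] by (simp add: words_def)
next
  case (flip xs y zs)
  then show ?case
    using assms(2) degenerate_flip[of xs y "zs @ [x]"] by (simp add: words_def)
qed (auto intro: degenerate_add)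

lemma act_chain_degenerate:
  assumes "u \<in> degenerate Q n" "x \<in> carrier Q"
  shows "act_chain Q x u \<in> degenerate Q n"
  using assms(1)
proof (induction u rule: degenerate_induct)
  case (uminus a)
  then show ?case
    using degenerate_uminus[of "act_chain Q x a"] act_chain_simps(5)[of Q x "-1" a] by simp
next
  case (repeat xs y zs)
  then have "act_list Q x (xs @ y # y # zs) \<in> words Q n"
    using assms(2) by blast
  then show ?case
    using degenerate_repeat[of "act_list Q x xs" "y \<triangleleft> x" "act_list Q x zs"] by simp
next
  case (flip xs y zs)
  then have "act_list Q x (xs @ y # zs) \<in> words Q n"
    using assms(2) by blast
  moreover have "set xs \<subseteq> carrier Q" "y \<in> carrier Q"
    using flip by (auto simp: words_def)
  ultimately show ?case
    using degenerate_flip[of "act_list Q x xs" "y \<triangleleft> x" "act_list Q x zs"] assms(2)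
    by (simp add: act_list_distrib rho_tri)
qed (auto intro: degenerate_add)

lemma repeat_chain_degenerate:
  assumes "Poly_Mapping.keys u \<subseteq> words Q n" "x \<in> carrier Q"
  shows "snoc_chain x (snoc_chain x u) \<in> degenerate Q (Suc (Suc n))"
  using assms(1)
proof (induction u rule: frag_induction)
  case (one xs)
  then show ?case
    using assms(2) degenerate_repeat[of xs x "[]"] by (auto simp: words_def)
qed (auto intro: degenerate_diff)

lemma flip_chain_degenerate:
  assumes "Poly_Mapping.keys u \<subseteq> words Q n" "x \<in> carrier Q"
  shows "snoc_chain x u + snoc_chain (\<rho> x) (act_chain Q x u) \<in> degenerate Q (Suc n)"
  using assms(1)
proof (induction u rule: frag_induction)
  case (one xs)
  then show ?case
    using assms(2) degenerate_flip[of xs x "[]"] by (auto simp: words_def)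
next
  case (diff a b)
  from degenerate_diff[OF diff] show ?case by (simp add: algebra_simps)
qed auto

text \<open>Induction on the suffix behind the repeated pair. If there is none, the faces at the two
  equal entries cancel because \<open>x\<close> acts trivially on itself, and every remaining face
  still ends in the pair.\<close>

lemma chain_bd_repeat_degenerate:
  "xs @ x # x # zs \<in> words Q (Suc n) \<Longrightarrow> chain_bd Q (frag_of (xs @ x # x # zs)) \<in> degenerate Q n"
proof (induction zs arbitrary: n rule: rev_induct)
  case Nil
  then have x: "x \<in> carrier Q" and xs: "xs \<in> words Q (length xs)" and n: "n = Suc (length xs)"
    by (auto simp: words_def)
  have eq: "chain_bd Q (frag_of (xs @ [x, x])) = snoc_chain x (snoc_chain x (chain_bd Q (frag_of xs)))"
    using chain_bd_snoc[of Q "xs @ [x]" x] chain_bd_snoc[of Q xs x] x tri_idem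
    by (simp add: frag_cmul_distrib2 algebra_simps) (simp flip: frag_cmul_distrib)
  show ?case
  proof (cases "xs = []")
    case False
    then obtain m where m: "length xs = Suc m"
      by (cases xs) auto
    then show ?thesis
      using eq n x xs keys_chain_bd_frag_of[of xs m] repeat_chain_degenerate by auto
  qed (use eq in simp)
next
  case (snoc z zs)
  then obtain m where n: "n = Suc m"
    by (cases n) (auto simp: words_def)
  have w: "xs @ x # x # zs \<in> words Q n" and z: "z \<in> carrier Q"
    using snoc.prems by (auto simp: words_def)
  have "chain_bd Q (frag_of (xs @ x # x # zs)) \<in> degenerate Q m"
    using snoc.IH w n by simp
  then show ?case
    using chain_bd_snoc[of Q "xs @ x # x # zs" z] z w degenerate_repeat[OF w] n
      act_chain_degenerate[OF degenerate_repeat[OF w] z]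
    by (auto simp del: power_Suc act_list_simps(2,3)
        intro!: degenerate_add degenerate_cmul degenerate_diff snoc_chain_degenerate)
qed

text \<open>Again induction on the suffix. If the flipped entry is last, its own faces in the two
  tuples cancel, since the action of \<open>\<rho> x\<close> undoes that of \<open>x\<close>; the
  remaining faces of the two tuples match up as flips at the last entry, because the action of
  \<open>x\<close> is a chain map.\<close>

lemma chain_bd_flip_degenerate:
  "xs @ x # zs \<in> words Q (Suc n) \<Longrightarrow>
   chain_bd Q (frag_of (xs @ x # zs) + frag_of (act_list Q x xs @ \<rho> x # zs)) \<in> degenerate Q n"
proof (induction zs arbitrary: n rule: rev_induct)
  case Nil
  then have x: "x \<in> carrier Q" and xs: "xs \<in> words Q (length xs)" and n: "n = length xs"
    by (auto simp: words_def)
  have eq: "chain_bd Q (frag_of (xs @ [x]) + frag_of (act_list Q x xs @ [\<rho> x]))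
      = snoc_chain x (chain_bd Q (frag_of xs)) + snoc_chain (\<rho> x) (act_chain Q x (chain_bd Q (frag_of xs)))"
    using x xs act_list_rho[of xs x]
    by (simp add: words_def chain_bd_snoc chain_bd_act_list frag_cmul_distrib2 algebra_simps)
      (simp add: algebra_simps flip: frag_cmul_distrib2 frag_cmul_distrib)
  show ?case
  proof (cases "xs = []")
    case False
    then obtain m where m: "length xs = Suc m"
      by (cases xs) auto
    then show ?thesis
      using eq n x xs keys_chain_bd_frag_of[of xs m] flip_chain_degenerate by auto
  qed (use eq in simp)
next
  case (snoc z zs)
  then obtain m where n: "n = Suc m"
    by (cases n) (auto simp: words_def)
  define u where "u = frag_of (xs @ x # zs) + frag_of (act_list Q x xs @ \<rho> x # zs)"
  have w: "xs @ x # zs \<in> words Q n" and z: "z \<in> carrier Q"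
    using snoc.prems by (auto simp: words_def)
  have bd: "chain_bd Q u \<in> degenerate Q m" and u: "u \<in> degenerate Q n"
    using snoc.IH w n degenerate_flip[OF w] by (simp_all add: u_def)
  have "Poly_Mapping.keys u \<subseteq> {xs. length xs = n}"
    using degenerate_keys[OF u] by (auto simp: tuples_def)
  then have "chain_bd Q (snoc_chain z u) = snoc_chain z (chain_bd Q u)
      + frag_cmul ((-1) ^ Suc n) (u - act_chain Q z u)"
    by (rule chain_bd_snoc_chain)
  moreover have "snoc_chain z u
      = frag_of (xs @ x # zs @ [z]) + frag_of (act_list Q x xs @ \<rho> x # zs @ [z])"
    by (simp add: u_def)
  ultimately show ?case
    using snoc_chain_degenerate[OF bd z] act_chain_degenerate[OF u z] u n
    by (metis degenerate_add degenerate_cmul degenerate_diff)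
qed

lemma chain_bd_degenerate: "u \<in> degenerate Q (Suc n) \<Longrightarrow> chain_bd Q u \<in> degenerate Q n"
proof (induction u rule: degenerate_induct)
  case (uminus a)
  then show ?case
    using degenerate_uminus[of "chain_bd Q a"] chain_bd_simps(5)[of Q "-1" a] by simp
qed (use chain_bd_repeat_degenerate chain_bd_flip_degenerate in \<open>auto intro: degenerate_add\<close>)

end

section \<open>Coordinates\<close>

text \<open>The flips at the single positions of a tuple commute and generate a group of order \<open>2 ^ n\<close>; the
  orbit is listed with the signs that the flips produce in the quotient by \<open>degenerate_rho\<close>.
  Lists are reversed here, as flipping an entry acts on the entries before it.\<close>

fun signed_orbit :: "('a, 'b) sym_quandle_scheme \<Rightarrow> 'a list \<Rightarrow> (int \<times> 'a list) list" where
  "signed_orbit Q [] = [(1, [])]"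
| "signed_orbit Q (x # r) =
     map (\<lambda>(s, ys). (s, ys @ [x])) (signed_orbit Q r)
     @ map (\<lambda>(s, ys). (- s, act_list Q x ys @ [\<rho>\<^bsub>Q\<^esub> x])) (signed_orbit Q r)"

definition coord :: "('a, 'b) sym_quandle_scheme \<Rightarrow> 'a list \<Rightarrow> ('a list \<Rightarrow>\<^sub>0 int) \<Rightarrow> int" where
  "coord Q r c = (\<Sum>(s, ys)\<leftarrow>signed_orbit Q (rev r). s * chi ys c)"

lemma chi_simps [simp]:
  "chi ys 0 = 0" "chi ys (a + b) = chi ys a + chi ys b" "chi ys (a - b) = chi ys a - chi ys b"
  "chi ys (- a) = - chi ys a" "chi ys (frag_cmul k a) = k * chi ys a"
  "chi ys (frag_of xs) = (if xs = ys then 1 else 0)"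
  by (simp_all add: chi_def lookup_add lookup_minus)

lemma sum_list_case_prod_simps:
  "(\<Sum>(s, y)\<leftarrow>l. s * (f y + g y)) = (\<Sum>(s, y)\<leftarrow>l. s * f y) + (\<Sum>(s, y)\<leftarrow>l. s * g y)"
  "(\<Sum>(s, y)\<leftarrow>l. s * (f y - g y)) = (\<Sum>(s, y)\<leftarrow>l. s * f y) - (\<Sum>(s, y)\<leftarrow>l. s * g y)"
  "(\<Sum>(s, y)\<leftarrow>l. s * (k * f y)) = k * (\<Sum>(s, y)\<leftarrow>l. s * f y)"
  "(\<Sum>(s, y)\<leftarrow>l. - (s * f y)) = - (\<Sum>(s, y)\<leftarrow>l. s * f y)"
  "(\<Sum>(s, y)\<leftarrow>l. 0 :: int) = 0"
  for f g :: "'a \<Rightarrow> int"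
  by (induction l) (auto simp: algebra_simps)

lemma coord_simps [simp]:
  "coord Q r 0 = 0" "coord Q r (a + b) = coord Q r a + coord Q r b"
  "coord Q r (a - b) = coord Q r a - coord Q r b" "coord Q r (frag_cmul k a) = k * coord Q r a"
  by (simp_all add: coord_def sum_list_case_prod_simps)

lemma coord_uminus [simp]: "coord Q r (- a) = - coord Q r a"
  using coord_simps(4)[of Q r "-1" a] by simp

text \<open>\<open>T\<close> picks one element from each orbit of the involution, which therefore
  has no fixed points. This makes the flips act freely on tuples, so that tuples over
  \<open>T\<close> represent their orbits without sign conflicts.\<close>

locale symmetric_quandle_transversal = symmetric_quandle Q
  for Q :: "('a, 'b) sym_quandle_scheme" (structure) +
  fixes T
  assumes finite_T: "finite T" and T_carrier: "T \<subseteq> carrier Q"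
    and T_cover: "x \<in> carrier Q \<Longrightarrow> x \<in> T \<or> \<rho> x \<in> T"
    and T_rho: "x \<in> T \<Longrightarrow> \<rho> x \<notin> T"
begin

definition reduced :: "nat \<Rightarrow> 'a list set" where
  "reduced n = {xs. length xs = n \<and> set xs \<subseteq> T \<and> distinct_adj xs}"

lemma finite_reduced: "finite (reduced n)"
  using finite_lists_length_eq[OF finite_T, of n] by (rule rev_finite_subset) (auto simp: reduced_def)

text \<open>Entries are moved into \<open>T\<close> from right to left. A flip changes only its own
  entry and those before it, so the suffix \<open>zs\<close> that already lies in \<open>T\<close>
  is never disturbed, and the length of the prefix \<open>ys\<close> decreases. A repetition that
  remains at the end makes the tuple degenerate.\<close>

lemma chain_induct [consumes 1, case_names degenerate diff reduced]:
  assumes c: "Poly_Mapping.keys c \<subseteq> words Q n"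
    and deg: "\<And>d. d \<in> degenerate Q n \<Longrightarrow> P d"
    and diff: "\<And>a b. P a \<Longrightarrow> P b \<Longrightarrow> P (a - b)"
    and red: "\<And>xs. xs \<in> reduced n \<Longrightarrow> P (frag_of xs)"
  shows "P c"
proof -
  have *: "P (frag_of (ys @ zs))" if "ys @ zs \<in> words Q n" "set zs \<subseteq> T" for ys zs
    using that
  proof (induction "length ys" arbitrary: ys zs)
    case 0
    show ?case
    proof (cases "distinct_adj zs")
      case True
      then show ?thesis
        using 0 red[of zs] by (auto simp: reduced_def words_def)
    next
      case False
      then obtain i where i: "Suc i < length zs" "zs ! i = zs ! Suc i"
        by (auto simp: distinct_adj_conv_nth)
      then have "zs = take i zs @ zs ! i # zs ! i # drop (Suc (Suc i)) zs"
        using id_take_nth_drop[of i zs] Cons_nth_drop_Suc[of "Suc i" zs] by simp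
      then show ?thesis
        using 0 deg degenerate_repeat[of "take i zs" "zs ! i" "drop (Suc (Suc i)) zs" n] by simp
    qed
  next
    case (Suc k)
    then obtain us y where ys: "ys = us @ [y]" "length us = k"
      by (cases ys rule: rev_cases) auto
    then have y: "y \<in> carrier Q" and w: "us @ y # zs \<in> words Q n"
      using Suc.prems by (auto simp: words_def)
    show ?case
    proof (cases "y \<in> T")
      case True
      then show ?thesis
        using Suc.hyps(1)[of us "y # zs"] Suc.prems ys by simp
    next
      case False
      then have "P (frag_of (act_list Q y us @ \<rho> y # zs))"
        using Suc.hyps(1)[of "act_list Q y us" "\<rho> y # zs"] Suc.prems ys T_cover[OF y] T_carrier y
          words_act_list[of us k y]
        by (auto simp: words_def)
      from diff[OF deg[OF degenerate_flip[OF w]] this] show ?thesis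
        by (simp add: ys)
    qed
  qed
  show ?thesis
    using c
  proof (induction c rule: frag_induction)
    case (one xs)
    then show ?case using *[of xs "[]"] by simp
  qed (auto intro: deg diff)
qed

lemma rho_eq_iff: "x \<in> carrier Q \<Longrightarrow> y \<in> carrier Q \<Longrightarrow> \<rho> x = y \<longleftrightarrow> x = \<rho> y"
  using rho_invol by metis

lemma signed_orbit_words:
  "set r \<subseteq> carrier Q \<Longrightarrow> (s, ys) \<in> set (signed_orbit Q r) \<Longrightarrow> set ys \<subseteq> carrier Q"
proof (induction r arbitrary: s ys)
  case (Cons x r)
  then show ?case
    by (auto simp: act_list_def rho_closed intro!: tri_closed) blast+
qed simp

lemma act_list_eq_iff:
  assumes "set xs \<subseteq> carrier Q" "set ys \<subseteq> carrier Q" "x \<in> carrier Q"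
  shows "act_list Q x xs = ys \<longleftrightarrow> xs = act_list Q (\<rho> x) ys"
  using assms act_list_rho by metis

text \<open>The orbit of \<open>r @ [x]\<close> has one half in which the last entry is kept and one
  in which it is flipped. In the second half the prefix has been acted on by \<open>x\<close>, which
  \<open>\<rho> x\<close> undoes.\<close>

lemma coord_snoc:
  assumes "set r \<subseteq> carrier Q" "x \<in> carrier Q" "set ys \<subseteq> carrier Q" "y \<in> carrier Q"
  shows "coord Q (r @ [x]) (frag_of (ys @ [y])) =
    (if y = x then coord Q r (frag_of ys) else 0)
    - (if y = \<rho> x then coord Q r (frag_of (act_list Q (\<rho> x) ys)) else 0)"
proof -
  let ?o = "signed_orbit Q (rev r)"
  have 1: "map (\<lambda>(s, zs). s * chi (zs @ [x]) (frag_of (ys @ [y]))) ?o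
      = map (\<lambda>(s, zs). if y = x then s * chi zs (frag_of ys) else 0) ?o"
    by (intro map_cong) auto
  have 2: "map (\<lambda>(s, zs). - s * chi (act_list Q x zs @ [\<rho> x]) (frag_of (ys @ [y]))) ?o
      = map (\<lambda>(s, zs). if y = \<rho> x then - (s * chi zs (frag_of (act_list Q (\<rho> x) ys))) else 0) ?o"
  proof (intro map_cong refl, clarify)
    fix s zs assume "(s, zs) \<in> set ?o"
    then have "set zs \<subseteq> carrier Q"
      using assms signed_orbit_words[of "rev r"] by auto
    then have "act_list Q x zs = ys \<longleftrightarrow> zs = act_list Q (\<rho> x) ys"
      using assms by (intro act_list_eq_iff)
    then show "- s * chi (act_list Q x zs @ [\<rho> x]) (frag_of (ys @ [y]))
        = (if y = \<rho> x then - (s * chi zs (frag_of (act_list Q (\<rho> x) ys))) else 0)"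
      by auto
  qed
  have "coord Q (r @ [x]) (frag_of (ys @ [y]))
      = (\<Sum>(s, zs)\<leftarrow>?o. s * chi (zs @ [x]) (frag_of (ys @ [y])))
        + (\<Sum>(s, zs)\<leftarrow>?o. - s * chi (act_list Q x zs @ [\<rho> x]) (frag_of (ys @ [y])))"
    by (simp only: coord_def rev_append rev.simps append.simps signed_orbit.simps map_append
        sum_list_append map_map o_def case_prod_beta' fst_conv snd_conv)
  also have "\<dots> = (if y = x then coord Q r (frag_of ys) else 0)
      - (if y = \<rho> x then coord Q r (frag_of (act_list Q (\<rho> x) ys)) else 0)"
    unfolding 1 2 coord_def
    by (cases "y = x"; cases "y = \<rho> x") (simp_all add: sum_list_case_prod_simps)
  finally show ?thesis .
qed

lemma coord_length:
  "length r \<noteq> length ys \<Longrightarrow> coord Q r (frag_of ys) = 0"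
proof -
  have len: "length zs = length r" if "(s, zs) \<in> set (signed_orbit Q r)" for s zs and r :: "'a list"
    using that by (induction r arbitrary: s zs) auto
  assume "length r \<noteq> length ys"
  then have "map (\<lambda>(s, zs). s * chi zs (frag_of ys)) (signed_orbit Q (rev r))
      = map (\<lambda>(s, zs). 0) (signed_orbit Q (rev r))"
    using len[of _ _ "rev r"] by (intro map_cong) auto
  then show ?thesis
    by (simp only: coord_def sum_list_case_prod_simps)
qed

text \<open>Induction on the last entry of \<open>r\<close>. A flip at the last position exchanges
  the two terms of \<open>coord_snoc\<close> and so changes the sign; a flip further left stays a
  flip after the action of \<open>\<rho> q\<close>, so the induction hypothesis covers both
  terms.\<close>

lemma coord_flip:
  assumes "set r \<subseteq> carrier Q" "set (xs @ x # zs) \<subseteq> carrier Q"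
  shows "coord Q r (frag_of (xs @ x # zs)) + coord Q r (frag_of (act_list Q x xs @ \<rho> x # zs)) = 0"
  using assms
proof (induction r arbitrary: xs x zs rule: rev_induct)
  case (snoc q r)
  show ?case
  proof (cases zs rule: rev_cases)
    case Nil
    moreover have "set (act_list Q x xs) \<subseteq> carrier Q"
      using snoc.prems by (auto simp: act_list_def tri_closed)
    ultimately show ?thesis
      using snoc.prems by (auto simp: coord_snoc rho_closed act_list_rho rho_eq_iff rho_invol)
  next
    case zs: (snoc zs' z)
    have c: "set (xs @ x # zs') \<subseteq> carrier Q" "z \<in> carrier Q" "set r \<subseteq> carrier Q" "q \<in> carrier Q"
      "set (act_list Q x xs @ \<rho> x # zs') \<subseteq> carrier Q"
      using snoc.prems zs by (auto simp: act_list_def tri_closed rho_closed)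
    have IH1: "coord Q r (frag_of (xs @ x # zs'))
        + coord Q r (frag_of (act_list Q x xs @ \<rho> x # zs')) = 0"
      using c by (intro snoc.IH)
    have act: "act_list Q (\<rho> q) (act_list Q x xs @ \<rho> x # zs')
        = act_list Q (x \<triangleleft> \<rho> q) (act_list Q (\<rho> q) xs) @ \<rho> (x \<triangleleft> \<rho> q) # act_list Q (\<rho> q) zs'"
      using c by (simp add: act_list_distrib rho_tri rho_closed)
    have IH2: "coord Q r (frag_of (act_list Q (\<rho> q) (xs @ x # zs')))
        + coord Q r (frag_of (act_list Q (\<rho> q) (act_list Q x xs @ \<rho> x # zs'))) = 0"
      unfolding act unfolding act_list_simps
      by (intro snoc.IH) (use c in \<open>auto simp: act_list_def rho_closed tri_closed\<close>)
    show ?thesis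
      using coord_snoc[OF c(3,4,1,2)] coord_snoc[OF c(3,4,5,2)] IH1 IH2 zs by auto
  qed
qed (simp add: coord_length)

text \<open>A tuple ending in \<open>x, x\<close> could meet the orbit of a word ending in
  \<open>p, q\<close> only if \<open>p\<close> is \<open>q\<close> or \<open>\<rho> q\<close>. The
  first is excluded by \<open>distinct_adj\<close>, the second because \<open>p\<close> and
  \<open>q\<close> both lie in \<open>T\<close>.\<close>

lemma coord_repeat:
  assumes "set r \<subseteq> T" "distinct_adj r" "set (xs @ x # x # zs) \<subseteq> carrier Q"
  shows "coord Q r (frag_of (xs @ x # x # zs)) = 0"
  using assms
proof (induction r arbitrary: xs x zs rule: rev_induct)
  case (snoc q r)
  have q: "q \<in> carrier Q" "set r \<subseteq> carrier Q"
    using snoc.prems T_carrier by auto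
  show ?case
  proof (cases zs rule: rev_cases)
    case Nil
    show ?thesis
    proof (cases r rule: rev_cases)
      case r: (snoc r' p)
      have pq: "p \<noteq> q" "p \<noteq> \<rho> q" "p \<in> carrier Q" "set r' \<subseteq> carrier Q"
        using snoc.prems T_carrier T_rho by (auto simp: r distinct_adj_append_iff)
      have "set (act_list Q (\<rho> q) xs) \<subseteq> carrier Q"
        using snoc.prems q by (auto simp: act_list_def tri_closed rho_closed)
      then show ?thesis
        using coord_snoc[of "r' @ [p]" q "xs @ [x]" x] coord_snoc[of r' p xs q]
          coord_snoc[of r' p "act_list Q (\<rho> q) xs" "\<rho> q"] snoc.prems pq q Nil
        by (auto simp: r rho_closed tri_idem rho_eq_iff rho_invol)
    qed (simp add: coord_length)
  next
    case zs: (snoc zs' z)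
    have c: "set (xs @ x # x # zs') \<subseteq> carrier Q" "z \<in> carrier Q" "set r \<subseteq> T" "distinct_adj r"
      using snoc.prems zs by auto
    have "coord Q r (frag_of (xs @ x # x # zs')) = 0"
      using c by (intro snoc.IH)
    moreover have "coord Q r (frag_of (act_list Q (\<rho> q) (xs @ x # x # zs'))) = 0"
      unfolding act_list_simps
      by (intro snoc.IH) (use c q in \<open>auto simp: act_list_def rho_closed tri_closed\<close>)
    ultimately show ?thesis
      using coord_snoc[OF q(2,1) c(1,2)] zs by auto
  qed
qed (simp add: coord_length)

lemma coord_degenerate:
  assumes "u \<in> degenerate Q n" "r \<in> reduced m"
  shows "coord Q r u = 0"
  using assms(1)
proof (induction u rule: degenerate_induct)
  case (repeat xs x zs)
  then show ?case
    using assms(2) by (intro coord_repeat) (auto simp: reduced_def words_def)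
next
  case (flip xs x zs)
  then show ?case
    using assms(2) T_carrier coord_flip[of r xs x zs] by (auto simp: reduced_def words_def)
qed auto

text \<open>The last entry that a flip pattern changes is not acted on afterwards, so it leaves
  \<open>T\<close>: an orbit contains only one word over \<open>T\<close>.\<close>

lemma coord_self:
  assumes "set r \<subseteq> T" "set xs \<subseteq> T"
  shows "coord Q r (frag_of xs) = (if xs = r then 1 else 0)"
  using assms
proof (induction r arbitrary: xs rule: rev_induct)
  case Nil
  then show ?case
    by (cases "xs = []") (auto simp: coord_def)
next
  case (snoc q r)
  show ?case
  proof (cases xs rule: rev_cases)
    case (snoc ys y)
    then have "q \<in> T" "y \<in> T" "set r \<subseteq> T" "set ys \<subseteq> T" "y \<noteq> \<rho> q"
      using snoc.prems T_rho[of q] by auto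
    moreover from this have "coord Q r (frag_of ys) = (if ys = r then 1 else 0)"
      by (intro snoc.IH)
    ultimately show ?thesis
      using coord_snoc[of r q ys y] subsetD[OF T_carrier] \<open>xs = ys @ [y]\<close> by (auto simp: subset_iff)
  qed (simp add: coord_length)
qed

text \<open>Subtracting from \<open>u\<close> its expansion in reduced words leaves a degenerate
  chain, which needs to be checked only on degenerate chains and reduced words. Thus the quotient is
  free on the reduced words with the coordinates as dual basis, and degeneracy becomes
  decidable.\<close>

lemma degenerate_iff_coord:
  assumes "Poly_Mapping.keys u \<subseteq> words Q n"
  shows "u \<in> degenerate Q n \<longleftrightarrow> (\<forall>r\<in>reduced n. coord Q r u = 0)"
proof
  assume *: "\<forall>r\<in>reduced n. coord Q r u = 0"
  have "u - (\<Sum>r\<in>reduced n. frag_cmul (coord Q r u) (frag_of r)) \<in> degenerate Q n"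
    using assms
  proof (induction u rule: chain_induct)
    case (diff a b)
    from degenerate_diff[OF diff] show ?case
      by (simp add: frag_cmul_diff_distrib sum_subtractf algebra_simps)
  next
    case (reduced xs)
    have "(\<Sum>r\<in>reduced n. frag_cmul (coord Q r (frag_of xs)) (frag_of r))
        = (\<Sum>r\<in>reduced n. if xs = r then frag_of r else 0)"
      using reduced by (intro sum.cong) (auto simp: reduced_def coord_self)
    then show ?case
      using reduced finite_reduced[of n] by (simp add: sum.delta)
  qed (simp add: coord_degenerate)
  then show "u \<in> degenerate Q n"
    using * by simp
qed (use coord_degenerate in blast)

end

section \<open>Homology and cohomology groups\<close>

text \<open>As \<open>h\<close> takes the value 1 it is onto, and \<open>x\<close> has the same
  value as the power of \<open>g\<close> with exponent \<open>h x\<close>, hence lies in the same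
  coset. Homology uses this with \<open>h\<close> a fixed cocycle, cohomology with \<open>h\<close>
  the evaluation at a fixed cycle.\<close>

lemma infinite_cyclic_quotient:
  assumes G: "group G" and h: "h \<in> hom G integer_group" and g: "g \<in> carrier G" "h g = 1"
    and N: "kernel G integer_group h = N"
  shows "G Mod N \<cong> integer_group"
    and "carrier (G Mod N) = generate (G Mod N) {N #>\<^bsub>G\<^esub> g}"
proof -
  interpret group_hom G integer_group h
    using G h by (simp add: group_hom_def group_hom_axioms_def)
  interpret N: normal N G
    using normal_kernel N by simp
  interpret F: group "G Mod N"
    by (rule N.factorgroup_is_group)
  have hpow: "h (g [^]\<^bsub>G\<^esub> k) = k" for k :: int
    using hom_int_pow[of g k] g by simp
  then have "h ` carrier G = carrier integer_group"
    using g by (auto intro!: image_eqI[of _ h "g [^]\<^bsub>G\<^esub> _"] G.int_pow_closed)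
  then show "G Mod N \<cong> integer_group"
    using FactGroup_iso N by simp
  have Ng: "N #>\<^bsub>G\<^esub> g \<in> carrier (G Mod N)"
    using g by (auto simp: carrier_FactGroup)
  have "X \<in> generate (G Mod N) {N #>\<^bsub>G\<^esub> g}" if X: "X \<in> carrier (G Mod N)" for X
  proof -
    obtain x where x: "x \<in> carrier G" "X = N #>\<^bsub>G\<^esub> x"
      using X by (auto simp: carrier_FactGroup)
    have "X = N #>\<^bsub>G\<^esub> (g [^]\<^bsub>G\<^esub> h x)"
      using FactGroup_subset[of x "g [^]\<^bsub>G\<^esub> h x"] FactGroup_subset[of "g [^]\<^bsub>G\<^esub> h x" x]
        x g hpow N by auto
    then have "X = (N #>\<^bsub>G\<^esub> g) [^]\<^bsub>G Mod N\<^esub> h x"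
      using N.FactGroup_int_pow[of g "h x"] g by simp
    then show ?thesis
      using F.generate_pow[OF Ng] by auto
  qed
  then show "carrier (G Mod N) = generate (G Mod N) {N #>\<^bsub>G\<^esub> g}"
    using F.generate_incl[of "{N #>\<^bsub>G\<^esub> g}"] Ng by blast
qed

lemma hom_int_add:
  "f \<in> hom G integer_group \<Longrightarrow> x \<in> carrier G \<Longrightarrow> y \<in> carrier G \<Longrightarrow> f (x \<otimes>\<^bsub>G\<^esub> y) = f x + f y"
  by (simp add: hom_def)

lemma group_hom_int_grp:
  assumes "group G"
  shows "group (hom_int_grp G)"
proof -
  interpret group G by fact
  show ?thesis
  proof (rule groupI)
    fix f assume f: "f \<in> carrier (hom_int_grp G)"
    have "(\<lambda>x\<in>carrier G. - f x) \<otimes>\<^bsub>hom_int_grp G\<^esub> f = \<one>\<^bsub>hom_int_grp G\<^esub>"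
      "(\<lambda>x\<in>carrier G. - f x) \<in> carrier (hom_int_grp G)"
      using f by (auto simp: hom_int_grp_def hom_def restrict_def extensional_def)
    then show "\<exists>g\<in>carrier (hom_int_grp G). g \<otimes>\<^bsub>hom_int_grp G\<^esub> f = \<one>\<^bsub>hom_int_grp G\<^esub>"
      by blast
  qed (auto simp: hom_int_grp_def hom_def restrict_def extensional_def fun_eq_iff)
qed

context symmetric_quandle
begin

section \<open>Cosets of chains, cycles and boundaries\<close>

abbreviation chains :: "nat \<Rightarrow> ('a list \<Rightarrow>\<^sub>0 int) set" where
  "chains n \<equiv> carrier (chain_grp Q n)"

lemma chains_diff: "a \<in> chains n \<Longrightarrow> b \<in> chains n \<Longrightarrow> a - b \<in> chains n"
  and chains_add: "a \<in> chains n \<Longrightarrow> b \<in> chains n \<Longrightarrow> a + b \<in> chains n"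
  by (simp_all add: keys_diff_subset keys_add_subset)

lemma degenerate_chains: "u \<in> degenerate Q n \<Longrightarrow> u \<in> chains n"
  by (simp add: degenerate_keys)

lemma chain_bd_chains: "1 < n \<Longrightarrow> c \<in> chains n \<Longrightarrow> chain_bd Q c \<in> chains (n - 1)"
  using keys_chain_bd[of c "n - 1"] by (simp add: tuples_eq_words)

lemma chain_bd_degenerate_pred: "u \<in> degenerate Q n \<Longrightarrow> 0 < n \<Longrightarrow> chain_bd Q u \<in> degenerate Q (n - 1)"
  using chain_bd_degenerate[of u "n - 1"] by simp

lemma chain_bd_twice: "c \<in> chains n \<Longrightarrow> chain_bd Q (chain_bd Q c) = 0"
  by (rule chain_bd_chain_bd[of _ n]) (auto simp: tuples_def words_def)

lemma normal_degenerate: "degenerate Q n \<lhd> chain_grp Q n"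
  using comm_group.subgroup_imp_normal[OF comm_group_chain_grp subgroup_degenerate] .

lemma group_chain_grp: "group (chain_grp Q n)"
  using comm_group_chain_grp comm_group.axioms(2) by blast

lemma comm_group_qchain_grp: "comm_group (qchain_grp Q n)"
  unfolding qchain_grp_def
  by (rule comm_group.abelian_FactGroup[OF comm_group_chain_grp subgroup_degenerate])

lemma group_qchain_grp: "group (qchain_grp Q n)"
  using comm_group_qchain_grp comm_group.axioms(2) by blast

lemma carrier_qchain_grp: "carrier (qchain_grp Q n) = qchain Q n ` chains n"
  unfolding qchain_grp_def qchain_def carrier_FactGroup ..

lemma qchain_in_carrier [intro]: "c \<in> chains n \<Longrightarrow> qchain Q n c \<in> carrier (qchain_grp Q n)"
  unfolding carrier_qchain_grp by (rule imageI)

lemma mult_qchain: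
  "a \<in> chains n \<Longrightarrow> b \<in> chains n \<Longrightarrow> qchain Q n a \<otimes>\<^bsub>qchain_grp Q n\<^esub> qchain Q n b = qchain Q n (a + b)"
  using normal.rcos_sum[OF normal_degenerate, of a n b]
  by (simp add: qchain_def qchain_grp_def)

lemma one_qchain: "\<one>\<^bsub>qchain_grp Q n\<^esub> = qchain Q n 0"
  using group.coset_mult_one[OF group_chain_grp subgroup.subset[OF subgroup_degenerate], of n]
  by (simp add: qchain_def qchain_grp_def)

lemma mem_qchain_iff: "x \<in> qchain Q n c \<longleftrightarrow> x - c \<in> degenerate Q n"
proof
  assume "x - c \<in> degenerate Q n"
  then have "(x - c) \<otimes>\<^bsub>chain_grp Q n\<^esub> c \<in> qchain Q n c"
    unfolding qchain_def r_coset_def by blast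
  then show "x \<in> qchain Q n c" by simp
qed (auto simp: qchain_def r_coset_def)

lemma qchain_eq_iff: "qchain Q n a = qchain Q n b \<longleftrightarrow> a - b \<in> degenerate Q n"
proof
  assume "qchain Q n a = qchain Q n b"
  moreover have "a \<in> qchain Q n a" by (simp add: mem_qchain_iff)
  ultimately show "a - b \<in> degenerate Q n" using mem_qchain_iff by blast
next
  assume ab: "a - b \<in> degenerate Q n"
  have "x - a \<in> degenerate Q n \<longleftrightarrow> x - b \<in> degenerate Q n" for x
    using degenerate_add[OF _ ab, of "x - a"] degenerate_diff[OF _ ab, of "x - b"] by auto
  then show "qchain Q n a = qchain Q n b"
    by (auto simp: mem_qchain_iff)
qed

lemma inv_qchain: "c \<in> chains n \<Longrightarrow> inv\<^bsub>qchain_grp Q n\<^esub> (qchain Q n c) = qchain Q n (- c)"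
  by (rule group.inv_equality[OF group_qchain_grp])
    (auto simp: mult_qchain one_qchain)

lemma qchain_bd_qchain:
  assumes "1 < n"
  shows "qchain_bd Q n (qchain Q n c) = qchain Q (n - 1) (chain_bd Q c)"
proof -
  have "(\<lambda>c. qchain Q (n - 1) (chain_bd Q c)) ` qchain Q n c = {qchain Q (n - 1) (chain_bd Q c)}"
  proof (intro equalityI subsetI)
    fix K assume "K \<in> (\<lambda>c. qchain Q (n - 1) (chain_bd Q c)) ` qchain Q n c"
    then obtain x where x: "x - c \<in> degenerate Q n" "K = qchain Q (n - 1) (chain_bd Q x)"
      by (auto simp: mem_qchain_iff)
    then have "chain_bd Q x - chain_bd Q c \<in> degenerate Q (n - 1)"
      using chain_bd_degenerate_pred[of "x - c" n] assms by simp
    with x show "K \<in> {qchain Q (n - 1) (chain_bd Q c)}"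
      by (simp add: qchain_eq_iff)
  qed (auto intro!: imageI simp: mem_qchain_iff)
  then show ?thesis by (simp add: qchain_bd_def)
qed

lemma qchain_mem_cycles_iff:
  assumes "1 < n" "c \<in> chains n"
  shows "qchain Q n c \<in> cycles Q n \<longleftrightarrow> chain_bd Q c \<in> degenerate Q (n - 1)"
  using assms qchain_in_carrier[OF assms(2)] qchain_eq_iff[of "n - 1" "chain_bd Q c" 0]
  by (simp add: cycles_def kernel_def one_qchain qchain_bd_qchain)

lemma cyclesE:
  assumes "K \<in> cycles Q n" "1 < n"
  obtains c where "c \<in> chains n" "K = qchain Q n c" "chain_bd Q c \<in> degenerate Q (n - 1)"
  using assms qchain_mem_cycles_iff unfolding cycles_def kernel_def carrier_qchain_grp by auto

lemma boundaries_eq: "0 < n \<Longrightarrow> boundaries Q n = (\<lambda>d. qchain Q n (chain_bd Q d)) ` chains (Suc n)"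
  by (simp add: boundaries_def carrier_qchain_grp image_image qchain_bd_qchain)

lemma boundaries_subset_cycles: "1 < n \<Longrightarrow> boundaries Q n \<subseteq> cycles Q n"
  using chain_bd_chains[of "Suc n"]
  by (auto simp: boundaries_eq qchain_mem_cycles_iff chain_bd_twice simp del: carrier_chain_grp)

lemma subgroup_cycles:
  assumes n: "1 < n"
  shows "subgroup (cycles Q n) (qchain_grp Q n)"
proof (rule group.subgroupI[OF group_qchain_grp])
  show "cycles Q n \<subseteq> carrier (qchain_grp Q n)"
    by (auto simp: cycles_def kernel_def)
  have "qchain Q n 0 \<in> cycles Q n"
    using n by (subst qchain_mem_cycles_iff) auto
  then show "cycles Q n \<noteq> {}" by blast
next
  fix K assume "K \<in> cycles Q n"
  then obtain c where c: "c \<in> chains n" "K = qchain Q n c" "chain_bd Q c \<in> degenerate Q (n - 1)"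
    using n by (rule cyclesE)
  moreover have "chain_bd Q (- c) = - chain_bd Q c"
    using chain_bd_simps(5)[of Q "-1" c] by simp
  ultimately show "inv\<^bsub>qchain_grp Q n\<^esub> K \<in> cycles Q n"
    using n by (simp add: inv_qchain qchain_mem_cycles_iff degenerate_uminus)
next
  fix K L assume "K \<in> cycles Q n" "L \<in> cycles Q n"
  then obtain c d where "c \<in> chains n" "K = qchain Q n c" "chain_bd Q c \<in> degenerate Q (n - 1)"
    "d \<in> chains n" "L = qchain Q n d" "chain_bd Q d \<in> degenerate Q (n - 1)"
    using n by (elim cyclesE)
  then show "K \<otimes>\<^bsub>qchain_grp Q n\<^esub> L \<in> cycles Q n"
    using n chains_add[of c n d] by (simp add: mult_qchain qchain_mem_cycles_iff degenerate_add)
qed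

abbreviation cycle_grp :: "nat \<Rightarrow> ('a list \<Rightarrow>\<^sub>0 int) set monoid" where
  "cycle_grp n \<equiv> (qchain_grp Q n)\<lparr>carrier := cycles Q n\<rparr>"

lemma group_cycle_grp: "1 < n \<Longrightarrow> group (cycle_grp n)"
  using group.subgroup_imp_group[OF group_qchain_grp subgroup_cycles] .

lemma trivial_homology:
  assumes "1 < n" "cycles Q n \<subseteq> boundaries Q n"
  shows "trivial_group (homology_grp Q n)"
proof -
  have B: "boundaries Q n = cycles Q n"
    using assms boundaries_subset_cycles by blast
  interpret group "cycle_grp n" by (rule group_cycle_grp[OF assms(1)])
  have sub: "subgroup (cycles Q n) (cycle_grp n)"
    using subgroup_self by simp
  have "comm_group (cycle_grp n)"
    using comm_groupE(4)[OF comm_group_qchain_grp] subgroup.subset[OF subgroup_cycles[OF assms(1)]]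
    by (intro group_comm_groupI) auto
  then have "group (cycle_grp n Mod cycles Q n)"
    using comm_group.subgroup_imp_normal[OF _ sub] normal.factorgroup_is_group by blast
  moreover have "carrier (cycle_grp n Mod cycles Q n) = {cycles Q n}"
  proof -
    have "cycles Q n #>\<^bsub>cycle_grp n\<^esub> K = cycles Q n" if "K \<in> cycles Q n" for K
      using coset_join2[OF _ sub that] that by simp
    then have "carrier (cycle_grp n Mod cycles Q n) = (\<lambda>K. cycles Q n) ` cycles Q n"
      unfolding carrier_FactGroup by (intro image_cong) simp_all
    moreover have "\<one>\<^bsub>cycle_grp n\<^esub> \<in> cycles Q n"
      using one_closed by simp
    ultimately show ?thesis
      by (simp only: image_constant)
  qed
  ultimately show ?thesis
    unfolding trivial_group_def homology_grp_def B by (simp only: one_FactGroup simp_thms)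
qed

section \<open>Cochains, cocycles and the pairing with homology\<close>

lemma hom_chains_diff:
  assumes "\<theta> \<in> hom (chain_grp Q n) integer_group" "a \<in> chains n" "b \<in> chains n"
  shows "\<theta> (a - b) = \<theta> a - \<theta> b"
  using hom_int_add[OF assms(1), of "a - b" b] chains_diff[OF assms(2,3)] assms(3) by simp

lemma induced_cochain_qchain:
  assumes \<theta>: "\<theta> \<in> hom (chain_grp Q n) integer_group" "\<forall>d\<in>degenerate Q n. \<theta> d = 0"
    and c: "c \<in> chains n"
  shows "induced_cochain Q n \<theta> (qchain Q n c) = \<theta> c"
proof -
  have "\<theta> x = \<theta> c" if "x \<in> qchain Q n c" for x
  proof -
    have x: "x - c \<in> degenerate Q n"
      using that by (simp add: mem_qchain_iff)
    then have "x \<in> chains n"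
      using chains_add[OF degenerate_chains[OF x] c] by simp
    then show ?thesis
      using hom_chains_diff[OF \<theta>(1) _ c, of x] \<theta>(2) x by simp
  qed
  then have "\<theta> ` qchain Q n c = (\<lambda>_. \<theta> c) ` qchain Q n c"
    by (intro image_cong) simp_all
  also have "\<dots> = {\<theta> c}"
    by (rule image_constant[of c]) (simp add: mem_qchain_iff)
  finally have "\<theta> ` qchain Q n c = {\<theta> c}" .
  then show ?thesis
    using c by (simp add: induced_cochain_def qchain_in_carrier del: carrier_chain_grp)
qed

lemma carrier_cochain_grp:
  "f \<in> carrier (cochain_grp Q n) \<longleftrightarrow>
     f \<in> hom (qchain_grp Q n) integer_group \<and> f \<in> extensional (carrier (qchain_grp Q n))"
  by (simp add: cochain_grp_def hom_int_grp_def)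

lemma cochain_add:
  assumes "f \<in> carrier (cochain_grp Q n)" "a \<in> chains n" "b \<in> chains n"
  shows "f (qchain Q n (a + b)) = f (qchain Q n a) + f (qchain Q n b)"
  using assms hom_int_add[of f "qchain_grp Q n" "qchain Q n a" "qchain Q n b"]
  by (simp add: carrier_cochain_grp mult_qchain qchain_in_carrier del: carrier_chain_grp)

lemma cochain_0: "f \<in> carrier (cochain_grp Q n) \<Longrightarrow> f (qchain Q n 0) = 0"
  using cochain_add[of f n 0 0] by simp

lemma cochain_diff:
  assumes "f \<in> carrier (cochain_grp Q n)" "a \<in> chains n" "b \<in> chains n"
  shows "f (qchain Q n (a - b)) = f (qchain Q n a) - f (qchain Q n b)"
  using cochain_add[OF assms(1) chains_diff[OF assms(2,3)] assms(3)] by simp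

lemma cochain_eqI:
  assumes "f \<in> carrier (cochain_grp Q n)" "g \<in> carrier (cochain_grp Q n)"
    and "\<And>c. c \<in> chains n \<Longrightarrow> f (qchain Q n c) = g (qchain Q n c)"
  shows "f = g"
  using assms by (intro extensionalityI[of _ "carrier (qchain_grp Q n)"])
    (auto simp: carrier_cochain_grp carrier_qchain_grp)

lemma induced_cochain_in_carrier:
  assumes \<theta>: "\<theta> \<in> hom (chain_grp Q n) integer_group" "\<forall>d\<in>degenerate Q n. \<theta> d = 0"
  shows "induced_cochain Q n \<theta> \<in> carrier (cochain_grp Q n)"
  unfolding carrier_cochain_grp
proof
  show "induced_cochain Q n \<theta> \<in> hom (qchain_grp Q n) integer_group"
  proof (rule homI)
    fix K L assume "K \<in> carrier (qchain_grp Q n)" "L \<in> carrier (qchain_grp Q n)"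
    then obtain a b where "K = qchain Q n a" "a \<in> chains n" "L = qchain Q n b" "b \<in> chains n"
      by (auto simp: carrier_qchain_grp simp del: carrier_chain_grp)
    then show "induced_cochain Q n \<theta> (K \<otimes>\<^bsub>qchain_grp Q n\<^esub> L)
        = induced_cochain Q n \<theta> K \<otimes>\<^bsub>integer_group\<^esub> induced_cochain Q n \<theta> L"
      using hom_int_add[OF \<theta>(1), of a b] chains_add[of a n b]
      by (simp add: mult_qchain induced_cochain_qchain[OF \<theta>] del: carrier_chain_grp)
  qed simp
qed (simp add: induced_cochain_def)

lemma cobd_qchain:
  assumes "0 < n" "d \<in> chains (Suc n)"
  shows "cobd Q (Suc n) f (qchain Q (Suc n) d) = f (qchain Q n (chain_bd Q d))"
  using assms qchain_in_carrier[OF assms(2)] by (simp add: cobd_def qchain_bd_qchain)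

lemma cobd_in_carrier:
  assumes n: "0 < n" and f: "f \<in> carrier (cochain_grp Q n)"
  shows "cobd Q (Suc n) f \<in> carrier (cochain_grp Q (Suc n))"
  unfolding carrier_cochain_grp
proof
  show "cobd Q (Suc n) f \<in> hom (qchain_grp Q (Suc n)) integer_group"
  proof (rule homI)
    fix K L assume "K \<in> carrier (qchain_grp Q (Suc n))" "L \<in> carrier (qchain_grp Q (Suc n))"
    then obtain a b where "K = qchain Q (Suc n) a" "a \<in> chains (Suc n)"
      "L = qchain Q (Suc n) b" "b \<in> chains (Suc n)"
      by (auto simp: carrier_qchain_grp simp del: carrier_chain_grp)
    then show "cobd Q (Suc n) f (K \<otimes>\<^bsub>qchain_grp Q (Suc n)\<^esub> L)
        = cobd Q (Suc n) f K \<otimes>\<^bsub>integer_group\<^esub> cobd Q (Suc n) f L"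
      using n chains_add[of a "Suc n" b] cochain_add[OF f] chain_bd_chains[of "Suc n"]
      by (simp add: mult_qchain cobd_qchain del: carrier_chain_grp)
  qed simp
qed (simp add: cobd_def)

lemma mem_cocycles_iff:
  assumes "0 < n"
  shows "f \<in> cocycles Q n \<longleftrightarrow> f \<in> carrier (cochain_grp Q n) \<and>
    (\<forall>d\<in>chains (Suc n). f (qchain Q n (chain_bd Q d)) = 0)"
proof -
  have "cobd Q (Suc n) f = \<one>\<^bsub>cochain_grp Q (Suc n)\<^esub> \<longleftrightarrow>
      (\<forall>K\<in>carrier (qchain_grp Q (Suc n)). f (qchain_bd Q (Suc n) K) = 0)"
    by (simp add: cobd_def cochain_grp_def hom_int_grp_def restrict_def fun_eq_iff Ball_def)
  also have "\<dots> \<longleftrightarrow> (\<forall>d\<in>chains (Suc n). f (qchain Q n (chain_bd Q d)) = 0)"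
    using assms by (simp add: carrier_qchain_grp qchain_bd_qchain del: carrier_chain_grp)
  finally have "cobd Q (Suc n) f = \<one>\<^bsub>cochain_grp Q (Suc n)\<^esub> \<longleftrightarrow>
      (\<forall>d\<in>chains (Suc n). f (qchain Q n (chain_bd Q d)) = 0)" .
  then show ?thesis
    by (simp add: cocycles_def kernel_def)
qed

lemma group_cochain_grp: "group (cochain_grp Q n)"
  unfolding cochain_grp_def by (rule group_hom_int_grp[OF group_qchain_grp])

lemma mult_cochain:
  "c \<in> chains n \<Longrightarrow> (f \<otimes>\<^bsub>cochain_grp Q n\<^esub> g) (qchain Q n c) = f (qchain Q n c) + g (qchain Q n c)"
  using qchain_in_carrier[of c n] by (simp add: cochain_grp_def hom_int_grp_def)

lemma one_cochain: "c \<in> chains n \<Longrightarrow> \<one>\<^bsub>cochain_grp Q n\<^esub> (qchain Q n c) = 0"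
  using qchain_in_carrier[of c n] by (simp add: cochain_grp_def hom_int_grp_def)

lemma subgroup_cocycles:
  assumes n: "0 < n"
  shows "subgroup (cocycles Q n) (cochain_grp Q n)"
proof -
  interpret group "cochain_grp Q n" by (rule group_cochain_grp)
  have bd: "chain_bd Q d \<in> chains n" if "d \<in> chains (Suc n)" for d
    using chain_bd_chains[of "Suc n" d] that n by simp
  show ?thesis
  proof (rule subgroupI)
    show "cocycles Q n \<subseteq> carrier (cochain_grp Q n)"
      using mem_cocycles_iff[OF n] by blast
    show "cocycles Q n \<noteq> {}"
      using mem_cocycles_iff[OF n, of "\<one>\<^bsub>cochain_grp Q n\<^esub>"] one_cochain bd by blast
  next
    fix f assume f: "f \<in> cocycles Q n"
    then have fc: "f \<in> carrier (cochain_grp Q n)"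
      using mem_cocycles_iff[OF n] by blast
    have "(inv\<^bsub>cochain_grp Q n\<^esub> f) (qchain Q n c) = - f (qchain Q n c)" if "c \<in> chains n" for c
      using mult_cochain[OF that, of "inv\<^bsub>cochain_grp Q n\<^esub> f" f] one_cochain[OF that] l_inv[OF fc]
      by simp
    then show "inv\<^bsub>cochain_grp Q n\<^esub> f \<in> cocycles Q n"
      using f bd inv_closed[OF fc] by (simp add: mem_cocycles_iff[OF n] del: carrier_chain_grp)
  next
    fix f g assume "f \<in> cocycles Q n" "g \<in> cocycles Q n"
    then show "f \<otimes>\<^bsub>cochain_grp Q n\<^esub> g \<in> cocycles Q n"
      using bd mult_cochain m_closed unfolding mem_cocycles_iff[OF n] by auto
  qed
qed

lemma cocycle_boundaries:
  assumes "0 < n" "f \<in> cocycles Q n" "K \<in> boundaries Q n"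
  shows "f K = 0"
  using assms mem_cocycles_iff[of n f] boundaries_eq[of n] by auto

lemma eval_homology_class:
  assumes n: "1 < n" and f: "f \<in> cocycles Q n" and z: "z \<in> chains n"
  shows "eval_class f (homology_class Q n (qchain Q n z)) = f (qchain Q n z)"
proof -
  have fh: "f \<in> hom (qchain_grp Q n) integer_group"
    using f mem_cocycles_iff[of n f] n carrier_cochain_grp by auto
  have "f (K \<otimes>\<^bsub>qchain_grp Q n\<^esub> qchain Q n z) = f (qchain Q n z)" if K: "K \<in> boundaries Q n" for K
    using hom_int_add[OF fh, of K "qchain Q n z"] cocycle_boundaries[OF _ f K] n K
      boundaries_subset_cycles[OF n] subgroup.subset[OF subgroup_cycles[OF n]] qchain_in_carrier[OF z]
    by auto
  \<comment> \<open>The class is nonempty, so that its image is a singleton and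
    \<open>the_elem\<close> yields its value.\<close>
  moreover have "qchain Q n (chain_bd Q 0) \<in> boundaries Q n"
    using n unfolding boundaries_eq[OF order.strict_trans[OF zero_less_one n]]
    by (intro imageI) simp
  ultimately have "f ` homology_class Q n (qchain Q n z) = {f (qchain Q n z)}"
    unfolding homology_class_def r_coset_def by (auto simp: image_iff)
  then show ?thesis
    by (simp add: eval_class_def)
qed

lemma is_cocycle_iff:
  assumes "0 < n"
  shows "is_cocycle Q n \<theta> \<longleftrightarrow> \<theta> \<in> hom (chain_grp Q n) integer_group \<and>
     (\<forall>d\<in>degenerate Q n. \<theta> d = 0) \<and> (\<forall>d\<in>chains (Suc n). \<theta> (chain_bd Q d) = 0)"
  using assms chain_bd_chains[of "Suc n"]
  by (auto simp: is_cocycle_def mem_cocycles_iff induced_cochain_in_carrier induced_cochain_qchain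
      simp del: carrier_chain_grp)

text \<open>The cocycle restricts to a homomorphism from cycles to integers that kills boundaries;
  \<open>exact\<close> says that it kills nothing else.\<close>

lemma homology_infinite_cyclic:
  assumes n: "1 < n" and \<theta>: "is_cocycle Q n \<theta>"
    and z: "z \<in> chains n" "chain_bd Q z \<in> degenerate Q (n - 1)" "\<theta> z = 1"
    and exact: "\<And>c. c \<in> chains n \<Longrightarrow> chain_bd Q c \<in> degenerate Q (n - 1) \<Longrightarrow> \<theta> c = 0 \<Longrightarrow>
      qchain Q n c \<in> boundaries Q n"
  shows "homology_grp Q n \<cong> integer_group"
    and "carrier (homology_grp Q n)
      = generate (homology_grp Q n) {homology_class Q n (qchain Q n z)}"
proof -
  define f where "f = induced_cochain Q n \<theta>"
  have f: "f \<in> cocycles Q n" and fq: "\<And>c. c \<in> chains n \<Longrightarrow> f (qchain Q n c) = \<theta> c"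
    using \<theta> by (simp_all add: f_def is_cocycle_def induced_cochain_qchain del: carrier_chain_grp)
  have "f \<in> hom (qchain_grp Q n) integer_group"
    using f n by (simp add: mem_cocycles_iff carrier_cochain_grp)
  then have hom: "f \<in> hom (cycle_grp n) integer_group"
    using subgroup.subset[OF subgroup_cycles[OF n]] by (auto simp: hom_def subset_iff)
  have ker: "kernel (cycle_grp n) integer_group f = boundaries Q n"
  proof (intro equalityI subsetI)
    fix K assume K: "K \<in> kernel (cycle_grp n) integer_group f"
    then have "K \<in> cycles Q n" by (simp add: kernel_def)
    then obtain c where "c \<in> chains n" "K = qchain Q n c" "chain_bd Q c \<in> degenerate Q (n - 1)"
      using n by (rule cyclesE)
    with K fq show "K \<in> boundaries Q n"
      by (auto simp: kernel_def intro!: exact simp del: carrier_chain_grp)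
  next
    fix K assume "K \<in> boundaries Q n"
    with n show "K \<in> kernel (cycle_grp n) integer_group f"
      using boundaries_subset_cycles[OF n] cocycle_boundaries[OF _ f] by (auto simp: kernel_def)
  qed
  have "qchain Q n z \<in> carrier (cycle_grp n)" "f (qchain Q n z) = 1"
    using z n fq by (simp_all add: qchain_mem_cycles_iff)
  from infinite_cyclic_quotient[OF group_cycle_grp[OF n] hom this ker]
  show "homology_grp Q n \<cong> integer_group"
    and "carrier (homology_grp Q n)
      = generate (homology_grp Q n) {homology_class Q n (qchain Q n z)}"
    by (simp_all add: homology_grp_def homology_class_def r_coset_def)
qed

text \<open>The roles are exchanged: the homomorphism is evaluation at \<open>z\<close>. It kills
  coboundaries because \<open>z\<close> is a cycle, and \<open>exact\<close> supplies the
  converse.\<close>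

lemma cohomology_infinite_cyclic:
  assumes n: "1 < n" and \<theta>: "is_cocycle Q n \<theta>"
    and z: "z \<in> chains n" "chain_bd Q z \<in> degenerate Q (n - 1)" "\<theta> z = 1"
    and exact: "\<And>f. f \<in> cocycles Q n \<Longrightarrow> f (qchain Q n z) = 0 \<Longrightarrow> f \<in> coboundaries Q n"
  shows "cohomology_grp Q n \<cong> integer_group"
    and "carrier (cohomology_grp Q n)
      = generate (cohomology_grp Q n) {cohomology_class Q n (induced_cochain Q n \<theta>)}"
proof -
  let ?G = "(cochain_grp Q n)\<lparr>carrier := cocycles Q n\<rparr>"
  have G: "group ?G"
    using n group.subgroup_imp_group[OF group_cochain_grp subgroup_cocycles] by simp
  have hom: "(\<lambda>f. f (qchain Q n z)) \<in> hom ?G integer_group"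
    using z(1) by (auto simp: hom_def mult_cochain)
  have ker: "kernel ?G integer_group (\<lambda>f. f (qchain Q n z)) = coboundaries Q n"
  proof (intro equalityI subsetI)
    fix f assume "f \<in> coboundaries Q n"
    then obtain g where g: "g \<in> carrier (cochain_grp Q (n - 1))" "f = cobd Q n g"
      by (auto simp: coboundaries_def)
    obtain m where m: "n = Suc m" "0 < m"
      using n by (cases n) auto
    have "f \<in> carrier (cochain_grp Q n)"
      using cobd_in_carrier[of m g] g m by simp
    moreover have "f (qchain Q n (chain_bd Q d)) = 0" if d: "d \<in> chains (Suc n)" for d
      using chain_bd_chains[of "Suc n" d] d g m cobd_qchain[of m "chain_bd Q d" g]
        chain_bd_twice[OF d] cochain_0[of g m] by simp
    moreover have "qchain Q m (chain_bd Q z) = qchain Q m 0"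
      using z(2) m by (simp add: qchain_eq_iff)
    then have "f (qchain Q n z) = 0"
      using z(1) g m cobd_qchain[of m z g] cochain_0[of g m] by simp
    ultimately show "f \<in> kernel ?G integer_group (\<lambda>f. f (qchain Q n z))"
      using n by (simp add: kernel_def mem_cocycles_iff)
  qed (auto simp: kernel_def intro: exact)
  have "induced_cochain Q n \<theta> \<in> carrier ?G" "induced_cochain Q n \<theta> (qchain Q n z) = 1"
    using \<theta> z by (simp_all add: is_cocycle_def induced_cochain_qchain del: carrier_chain_grp)
  from infinite_cyclic_quotient[OF G hom this ker]
  show "cohomology_grp Q n \<cong> integer_group"
    and "carrier (cohomology_grp Q n)
      = generate (cohomology_grp Q n) {cohomology_class Q n (induced_cochain Q n \<theta>)}"
    by (simp_all add: cohomology_grp_def cohomology_class_def r_coset_def)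
qed

end

section \<open>The six-element quandle\<close>

text \<open>The recursion \<open>coord_snoc\<close> on reversed words, for evaluation: entries are
  compared one by one instead of listing the whole orbit. The exclusive branches are correct where
  \<open>x\<close> differs from \<open>\<rho> x\<close>. The last equation is reached only when one
  list is empty, so it tests whether both are.\<close>

fun coord_rev :: "('a, 'b) sym_quandle_scheme \<Rightarrow> 'a list \<Rightarrow> 'a list \<Rightarrow> int" where
  "coord_rev Q (x # r) (y # ys) =
     (if y = x then coord_rev Q r ys
      else if y = \<rho>\<^bsub>Q\<^esub> x then - coord_rev Q r (act_list Q (\<rho>\<^bsub>Q\<^esub> x) ys)
      else 0)"
| "coord_rev Q r ys = (if r = ys then 1 else 0)"

lemma (in symmetric_quandle_transversal) coord_eq_coord_rev:
  assumes "set r \<subseteq> T" "set xs \<subseteq> carrier Q"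
  shows "coord Q r (frag_of xs) = coord_rev Q (rev r) (rev xs)"
  using assms
proof (induction r arbitrary: xs rule: rev_induct)
  case Nil
  then show ?case
    by (cases xs rule: rev_cases) (auto simp: coord_def)
next
  case (snoc q r)
  show ?case
  proof (cases xs rule: rev_cases)
    case Nil
    then show ?thesis by (simp add: coord_length)
  next
    case xs: (snoc ys y)
    have c: "set r \<subseteq> carrier Q" "q \<in> carrier Q" "set ys \<subseteq> carrier Q" "y \<in> carrier Q" "q \<noteq> \<rho> q"
      using snoc.prems T_carrier T_rho[of q] xs by auto
    have "set (act_list Q (\<rho> q) ys) \<subseteq> carrier Q"
      using c by (auto simp: act_list_def tri_closed rho_closed)
    moreover have "rev (act_list Q (\<rho> q) ys) = act_list Q (\<rho> q) (rev ys)"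
      by (simp add: act_list_def rev_map)
    ultimately show ?thesis
      using coord_snoc[OF c(1-4)] snoc.IH[of ys] snoc.IH[of "act_list Q (\<rho> q) ys"] snoc.prems c
      by (auto simp: xs)
  qed
qed

definition transversal :: "nat set" where
  "transversal = {0, 1, 2}"

interpretation R3: symmetric_quandle_transversal R3 transversal
proof -
  interpret symmetric_quandle R3 by (rule symmetric_quandle_R3)
  show "symmetric_quandle_transversal R3 transversal"
    by unfold_locales (auto simp: R3_def transversal_def)
qed

text \<open>An integer combination of coordinates, stored as a list so that it can be data in a
  computation. \<open>comb_frag\<close> and \<open>comb_bd\<close> are its executable values on a
  tuple and on the boundary of a tuple.\<close>

definition comb :: "(int \<times> nat list) list \<Rightarrow> (nat list \<Rightarrow>\<^sub>0 int) \<Rightarrow> int" where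
  "comb l c = (\<Sum>(k, r)\<leftarrow>l. k * coord R3 r c)"

definition comb_frag :: "(int \<times> nat list) list \<Rightarrow> nat list \<Rightarrow> int" where
  "comb_frag l xs = (\<Sum>(k, r)\<leftarrow>l. k * coord_rev R3 (rev r) (rev xs))"

definition comb_bd :: "(int \<times> nat list) list \<Rightarrow> nat list \<Rightarrow> int" where
  "comb_bd l xs = (\<Sum>i\<leftarrow>[0..<length xs]. (-1) ^ Suc i *
     (comb_frag l (take i xs @ drop (Suc i) xs) - comb_frag l (act_before R3 i xs @ drop (Suc i) xs)))"

definition reduced_comb :: "nat \<Rightarrow> (int \<times> nat list) list \<Rightarrow> bool" where
  "reduced_comb n l \<longleftrightarrow> (\<forall>(k, r)\<in>set l. r \<in> R3.reduced n)"

definition reduced_list :: "nat \<Rightarrow> nat list list" where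
  "reduced_list n = filter distinct_adj (List.n_lists n [0, 1, 2])"

lemma reduced_eq_reduced_list: "R3.reduced n = set (reduced_list n)"
  unfolding R3.reduced_def unfolding transversal_def reduced_list_def by (auto simp: set_n_lists)

lemma comb_simps [simp]:
  "comb l 0 = 0" "comb l (a + b) = comb l a + comb l b" "comb l (a - b) = comb l a - comb l b"
  "comb l (frag_cmul k a) = k * comb l a"
  by (simp_all add: comb_def sum_list_case_prod_simps)

lemma comb_sum: "comb l (sum f S) = (\<Sum>x\<in>S. comb l (f x))"
  by (induction S rule: infinite_finite_induct) auto

lemma comb_degenerate:
  assumes "reduced_comb n l" "u \<in> degenerate R3 n"
  shows "comb l u = 0"
  using assms by (induction l) (auto simp: comb_def reduced_comb_def R3.coord_degenerate)

lemma comb_frag_of: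
  assumes "reduced_comb n l" "set xs \<subseteq> carrier R3"
  shows "comb l (frag_of xs) = comb_frag l xs"
  using assms
  by (induction l) (auto simp: comb_def comb_frag_def reduced_comb_def R3.reduced_def
      R3.coord_eq_coord_rev)

lemma comb_chain_bd:
  assumes "reduced_comb n l" "set xs \<subseteq> carrier R3"
  shows "comb l (chain_bd R3 (frag_of xs)) = comb_bd l xs"
proof -
  have "comb l (chain_bd R3 (frag_of xs)) = (\<Sum>i<length xs. (-1) ^ Suc i *
      (comb_frag l (take i xs @ drop (Suc i) xs) - comb_frag l (act_before R3 i xs @ drop (Suc i) xs)))"
    unfolding chain_bd_def frag_extend_of comb_sum
  proof (intro sum.cong refl)
    fix i assume i: "i \<in> {..<length xs}"
    have "set (take i xs @ drop (Suc i) xs) \<subseteq> carrier R3"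
      "set (act_before R3 i xs @ drop (Suc i) xs) \<subseteq> carrier R3"
      using assms(2) i by (auto simp: act_before_def intro!: R3.tri_closed
          dest!: in_set_takeD in_set_dropD)
    then show "comb l (frag_cmul ((-1) ^ Suc i) (frag_of (take i xs @ drop (Suc i) xs)
          - frag_of (act_before R3 i xs @ drop (Suc i) xs)))
        = (-1) ^ Suc i * (comb_frag l (take i xs @ drop (Suc i) xs)
          - comb_frag l (act_before R3 i xs @ drop (Suc i) xs))"
      using comb_frag_of[OF assms(1)] by simp
  qed
  then show ?thesis
    by (simp only: comb_bd_def interv_sum_list_conv_sum_set_nat atLeast0LessThan set_upt)
qed

lemma reduced_list_carrier: "xs \<in> set (reduced_list n) \<Longrightarrow> set xs \<subseteq> carrier R3"
  using R3.T_carrier by (auto simp: reduced_list_def set_n_lists transversal_def)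

lemma chains_eqI:
  fixes F G :: "(nat list \<Rightarrow>\<^sub>0 int) \<Rightarrow> int"
  assumes "\<And>a b. F (a - b) = F a - F b" "\<And>a b. G (a - b) = G a - G b"
    and "\<And>d. d \<in> degenerate R3 n \<Longrightarrow> F d = G d"
    and "\<And>xs. xs \<in> set (reduced_list n) \<Longrightarrow> F (frag_of xs) = G (frag_of xs)"
    and "c \<in> carrier (chain_grp R3 n)" "0 < n"
  shows "F c = G c"
proof -
  have "Poly_Mapping.keys c \<subseteq> words R3 n"
    using assms(5,6) by (simp add: tuples_eq_words)
  then show ?thesis
    by (induction c rule: R3.chain_induct) (simp_all add: assms(1-4) reduced_eq_reduced_list)
qed

lemma reduced_comb_iff: "reduced_comb n l \<longleftrightarrow> (\<forall>(k, r)\<in>set l. r \<in> set (reduced_list n))"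
  by (simp add: reduced_comb_def reduced_eq_reduced_list)

text \<open>In cohomological terms, the coboundary of the cochain \<open>l\<close> is
  \<open>l'\<close>. Both sides vanish on degenerate chains, as these form a subcomplex, so
  evaluation on the reduced tuples suffices.\<close>

lemma comb_chain_bd_eq:
  assumes red: "\<forall>(k, r)\<in>set l. r \<in> set (reduced_list n)" "\<forall>(k, r)\<in>set l'. r \<in> set (reduced_list (Suc n))"
    and check: "\<forall>xs\<in>set (reduced_list (Suc n)). comb_bd l xs = comb_frag l' xs"
    and c: "c \<in> carrier (chain_grp R3 (Suc n))"
  shows "comb l (chain_bd R3 c) = comb l' c"
  using _ _ _ _ c
proof (rule chains_eqI)
  fix d assume "d \<in> degenerate R3 (Suc n)"
  then show "comb l (chain_bd R3 d) = comb l' d"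
    using red R3.chain_bd_degenerate
    by (simp add: comb_degenerate[of n] comb_degenerate[of "Suc n"] reduced_comb_iff)
next
  fix xs assume xs: "xs \<in> set (reduced_list (Suc n))"
  then show "comb l (chain_bd R3 (frag_of xs)) = comb l' (frag_of xs)"
    using red check reduced_list_carrier[OF xs]
    by (simp add: comb_chain_bd[of n] comb_frag_of[of "Suc n"] reduced_comb_iff)
qed simp_all

section \<open>Chains modulo boundaries in terms of a few tuples\<close>

definition lin_chain :: "(int \<times> nat list) list \<Rightarrow> nat list \<Rightarrow>\<^sub>0 int" where
  "lin_chain w = (\<Sum>(k, xs)\<leftarrow>w. frag_cmul k (frag_of xs))"

lemma lin_chain_chains:
  "\<forall>(k, xs)\<in>set w. xs \<in> tuples R3 n \<Longrightarrow> lin_chain w \<in> carrier (chain_grp R3 n)"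
proof (induction w)
  case (Cons p w)
  obtain k xs where p: "p = (k, xs)" by (cases p)
  have "frag_cmul k (frag_of xs) \<in> carrier (chain_grp R3 n)"
    using Cons.prems p by (auto intro!: order.trans[OF keys_cmul])
  from R3.chains_add[OF this Cons.IH] Cons.prems show ?case
    by (simp add: lin_chain_def p)
qed (simp add: lin_chain_def)

lemma comb_chain_bd_lin_chain:
  assumes "reduced_comb n l" "\<forall>(k, xs)\<in>set w. xs \<in> tuples R3 m"
  shows "comb l (chain_bd R3 (lin_chain w)) = (\<Sum>(k, xs)\<leftarrow>w. k * comb_bd l xs)"
  using assms(2)
  by (induction w) (auto simp: lin_chain_def comb_chain_bd[OF assms(1)] tuples_def)

text \<open>In an entry \<open>(l, k, t)\<close> the functional \<open>l\<close> gives the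
  coefficient of the signed basis tuple \<open>k * t\<close>; for the tables below this is a
  projection onto the span of the chosen tuples along the boundaries, modulo degenerate
  chains.\<close>

definition expand ::
    "((int \<times> nat list) list \<times> int \<times> nat list) list \<Rightarrow> (nat list \<Rightarrow>\<^sub>0 int) \<Rightarrow> nat list \<Rightarrow>\<^sub>0 int" where
  "expand ps c = lin_chain (map (\<lambda>(l, k, t). (comb l c * k, t)) ps)"

lemma expand_diff [simp]: "expand ps (a - b) = expand ps a - expand ps b"
  by (induction ps)
    (auto simp: expand_def lin_chain_def left_diff_distrib frag_cmul_diff_distrib algebra_simps)

lemma comb_expand:
  assumes "reduced_comb n l" "\<forall>(m, k, t)\<in>set ps. t \<in> tuples R3 n"
  shows "comb l (expand ps c) = (\<Sum>(m, k, t)\<leftarrow>ps. comb m c * k * comb_frag l t)"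
  using assms(2)
  by (induction ps) (auto simp: expand_def lin_chain_def comb_frag_of[OF assms(1)] tuples_def)

text \<open>For a table \<open>w\<close> of chains one degree up, the last condition says that every reduced basis
  tuple equals its expansion plus the boundary of its entry in \<open>w\<close>, modulo degenerate chains.\<close>

definition decomposes :: "nat \<Rightarrow> ((int \<times> nat list) list \<times> int \<times> nat list) list \<Rightarrow>
    (nat list \<Rightarrow> (int \<times> nat list) list) \<Rightarrow> bool" where
  "decomposes n ps w \<longleftrightarrow>
     (\<forall>(l, k, t)\<in>set ps. t \<in> set (reduced_list n) \<and> (\<forall>(j, r)\<in>set l. r \<in> set (reduced_list n))) \<and>
     (\<forall>xs\<in>set (reduced_list n). \<forall>(k, ys)\<in>set (w xs). ys \<in> set (reduced_list (Suc n))) \<and>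
     (\<forall>r\<in>set (reduced_list n). \<forall>xs\<in>set (reduced_list n). comb_frag [(1, r)] xs =
        (\<Sum>(l, k, t)\<leftarrow>ps. comb_frag l xs * k * comb_frag [(1, r)] t)
        + (\<Sum>(k, ys)\<leftarrow>w xs. k * comb_bd [(1, r)] ys))"

lemma reduced_list_tuples: "xs \<in> set (reduced_list n) \<Longrightarrow> 0 < n \<Longrightarrow> xs \<in> tuples R3 n"
  using reduced_list_carrier[of xs n] by (auto simp: reduced_list_def set_n_lists tuples_def)

lemma decomposes_reduced:
  assumes dec: "decomposes n ps w" and n: "0 < n" and xs: "xs \<in> set (reduced_list n)"
  shows "lin_chain (w xs) \<in> carrier (chain_grp R3 (Suc n))"
    and "frag_of xs - expand ps (frag_of xs) - chain_bd R3 (lin_chain (w xs)) \<in> degenerate R3 n"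
proof -
  let ?u = "frag_of xs - expand ps (frag_of xs) - chain_bd R3 (lin_chain (w xs))"
  have w: "\<forall>(k, ys)\<in>set (w xs). ys \<in> tuples R3 (Suc n)"
    using dec xs reduced_list_tuples unfolding decomposes_def by fast
  then show w_chain: "lin_chain (w xs) \<in> carrier (chain_grp R3 (Suc n))"
    by (rule lin_chain_chains)
  have ps: "\<forall>(l, k, t)\<in>set ps. t \<in> tuples R3 n"
    and red: "\<forall>(l, k, t)\<in>set ps. reduced_comb n l"
    using dec n reduced_list_tuples unfolding decomposes_def reduced_comb_iff by fast+
  have coord: "coord R3 r ?u = 0" if r: "r \<in> R3.reduced n" for r
  proof -
    have l: "reduced_comb n [(1, r)]"
      using r by (simp add: reduced_comb_def)
    have "(\<Sum>(l, k, t)\<leftarrow>ps. comb l (frag_of xs) * k * comb_frag [(1, r)] t)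
        = (\<Sum>(l, k, t)\<leftarrow>ps. comb_frag l xs * k * comb_frag [(1, r)] t)"
      using red comb_frag_of[OF _ reduced_list_carrier[OF xs]]
      by (intro arg_cong[where f = sum_list] map_cong) auto
    then have "comb [(1, r)] ?u = 0"
      using dec r xs reduced_list_carrier[OF xs]
      by (simp add: comb_chain_bd_lin_chain[OF l w] comb_expand[OF l ps] comb_frag_of[OF l]
          decomposes_def reduced_eq_reduced_list)
    then show ?thesis
      by (simp add: comb_def)
  qed
  have "expand ps (frag_of xs) \<in> carrier (chain_grp R3 n)"
    unfolding expand_def using ps by (intro lin_chain_chains) auto
  moreover have "frag_of xs \<in> carrier (chain_grp R3 n)"
    using reduced_list_tuples[OF xs n] by simp
  ultimately have "?u \<in> carrier (chain_grp R3 n)"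
    using R3.chain_bd_chains[OF _ w_chain] n by (intro R3.chains_diff) simp_all
  then have "Poly_Mapping.keys ?u \<subseteq> words R3 n"
    using n by (simp add: tuples_eq_words)
  then show "?u \<in> degenerate R3 n"
    using coord R3.degenerate_iff_coord by blast
qed

text \<open>The property is stable under differences and holds on reduced tuples by the table. On a
  degenerate chain all the functionals vanish, so the expansion is zero and \<open>d = 0\<close>
  works.\<close>

lemma decomposes_chains:
  assumes dec: "decomposes n ps w" and n: "0 < n" and c: "c \<in> carrier (chain_grp R3 n)"
  obtains d where "d \<in> carrier (chain_grp R3 (Suc n))"
    "c - expand ps c - chain_bd R3 d \<in> degenerate R3 n"
proof -
  have "Poly_Mapping.keys c \<subseteq> words R3 n"
    using c n by (simp add: tuples_eq_words)
  then have "\<exists>d\<in>carrier (chain_grp R3 (Suc n)). c - expand ps c - chain_bd R3 d \<in> degenerate R3 n"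
  proof (induction c rule: R3.chain_induct)
    case (degenerate u)
    have "comb l u = 0" if "(l, k, t) \<in> set ps" for l k t
      using that dec degenerate by (intro comb_degenerate) (auto simp: decomposes_def reduced_comb_iff)
    then have "expand ps u = lin_chain (map (\<lambda>(l, k, t). (0, t)) ps)"
      unfolding expand_def by (intro arg_cong[where f = lin_chain] map_cong) auto
    moreover have "lin_chain (map (\<lambda>(l, k, t). (0, t)) ps) = 0"
      by (induction ps) (auto simp: lin_chain_def)
    ultimately show ?case
      using degenerate by (intro bexI[of _ 0]) simp_all
  next
    case (diff a b)
    then obtain d e where "d \<in> carrier (chain_grp R3 (Suc n))" "e \<in> carrier (chain_grp R3 (Suc n))"
      "a - expand ps a - chain_bd R3 d \<in> degenerate R3 n"
      "b - expand ps b - chain_bd R3 e \<in> degenerate R3 n"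
      by blast
    with R3.degenerate_diff[of "a - expand ps a - chain_bd R3 d" n "b - expand ps b - chain_bd R3 e"]
    show ?case
      by (intro bexI[of _ "d - e"] R3.chains_diff) (simp_all add: algebra_simps)
  next
    case (reduced xs)
    then show ?case
      using decomposes_reduced[OF dec n, of xs]
      by (intro bexI[of _ "lin_chain (w xs)"]) (simp_all add: reduced_eq_reduced_list)
  qed
  then show thesis
    using that by blast
qed

text \<open>The boundary of a \<open>3\<close>-chain \<open>c\<close> is \<open>part 0 c * e\<^sub>0 + \<dots> + part 3 c * e\<^sub>3\<close> modulo degenerate chains,
  where the only relation among the \<open>2\<close>-chains \<open>e\<^sub>i\<close> is that their sum vanishes. Hence \<open>c\<close> is a cycle
  if and only if the four values \<open>part i c\<close> agree.\<close>

definition parts :: "(int \<times> nat list) list list" where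
  "parts = [[(1, [0, 1, 0]), (1, [0, 1, 2]), (-1, [0, 2, 1])],
            [(1, [0, 2, 0]), (1, [1, 0, 1]), (1, [2, 1, 2])],
            [(1, [1, 2, 0]), (1, [1, 2, 1]), (-1, [1, 0, 2])],
            [(1, [2, 0, 1]), (1, [2, 0, 2]), (-1, [2, 1, 0])]]"

definition part :: "nat \<Rightarrow> (nat list \<Rightarrow>\<^sub>0 int) \<Rightarrow> int" where
  "part i = comb (parts ! i)"

text \<open>The order matches \<open>parts\<close>: the term at index \<open>i\<close> lies in the
  support of \<open>part i\<close>, and its sign is the value of \<open>part i\<close> on its tuple.
  Zipping the two lists therefore pairs the signed terms with their dual functionals.\<close>

definition cyc_terms :: "(int \<times> nat list) list" where
  "cyc_terms = [(-1, [0, 2, 1]), (1, [2, 1, 2]), (-1, [1, 0, 2]), (1, [2, 0, 1])]"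

lemma cyc_eq_lin_chain: "cyc = lin_chain cyc_terms"
  by (simp add: cyc_def lin_chain_def cyc_terms_def)

text \<open>Found by a computer search among short combinations of boundaries; the tuples that are missing
  from the table are the terms of the expansions.\<close>

definition filling :: "nat list \<Rightarrow> (int \<times> nat list) list" where
  "filling xs = (case map_of
     [([0, 1, 0], [(-1, [0, 1, 2, 0]), (1, [0, 2, 1, 2]), (-1, [1, 0, 1, 0])]),
      ([0, 1, 2], [(1, [0, 1, 0, 1]), (-1, [1, 2, 1, 0]), (1, [2, 0, 2, 1])]),
      ([0, 2, 0], [(1, [0, 1, 2, 0]), (1, [1, 2, 0, 1]), (1, [1, 2, 1, 0])]),
      ([1, 0, 1], [(-1, [0, 1, 0, 2]), (-1, [0, 1, 2, 0]), (-1, [2, 0, 1, 2])]),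
      ([1, 2, 0], [(1, [0, 1, 0, 2]), (1, [1, 2, 1, 2]), (-1, [2, 0, 2, 1])]),
      ([1, 2, 1], [(1, [0, 1, 0, 1]), (1, [1, 0, 2, 0]), (1, [2, 0, 2, 1])]),
      ([2, 0, 2], [(-1, [0, 1, 2, 1]), (-1, [0, 2, 0, 1]), (-1, [1, 0, 1, 0])]),
      ([2, 1, 0], [(1, [0, 1, 0, 1]), (1, [2, 1, 0, 2]), (1, [2, 1, 2, 1])]),
      ([0, 2], [(1, [0, 1, 0])]), ([1, 2], [(1, [2, 0, 1])]), ([1, 0], [(1, [2, 0, 1]), (1, [1, 2, 0])])] xs
   of None \<Rightarrow> [] | Some w \<Rightarrow> w)"

lemma decomposes_3: "decomposes 3 (zip parts cyc_terms) filling"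
  by code_simp

text \<open>Modulo boundaries, \<open>[0, 1]\<close>, \<open>[2, 0]\<close> and
  \<open>[2, 1]\<close> span the 2-chains, and the lists are the dual functionals. For example,
  \<open>[1, 0]\<close> becomes minus \<open>[0, 1]\<close> plus \<open>[2, 0]\<close> minus
  \<open>[2, 1]\<close>.\<close>

definition edge_terms :: "((int \<times> nat list) list \<times> int \<times> nat list) list" where
  "edge_terms =
     [([(1, [0, 1]), (1, [0, 2]), (-1, [1, 0])], 1, [0, 1]),
      ([(1, [2, 0]), (-1, [0, 2]), (1, [1, 2]), (1, [1, 0])], 1, [2, 0]),
      ([(1, [2, 1]), (-1, [1, 2]), (-1, [1, 0])], 1, [2, 1])]"

lemma decomposes_2: "decomposes 2 edge_terms filling"
  by code_simp

lemma trivial_homology_2: "trivial_group (homology_grp R3 2)"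
proof (rule R3.trivial_homology)
  show "cycles R3 2 \<subseteq> boundaries R3 2"
  proof
    fix K assume "K \<in> cycles R3 2"
    then obtain c where c: "c \<in> carrier (chain_grp R3 2)" "K = qchain R3 2 c"
      "chain_bd R3 c \<in> degenerate R3 1"
      by (rule R3.cyclesE) simp_all
    \<comment> \<open>The list \<open>l'\<close> is the coboundary of the coordinate
      \<open>r\<close> of 1-chains, so it vanishes on the cycle \<open>c\<close>.\<close>
    have 0: "comb l' c = 0"
      if "r \<in> set (reduced_list 1)" "\<forall>(k, r)\<in>set l'. r \<in> set (reduced_list 2)"
        "\<forall>xs\<in>set (reduced_list 2). comb_bd [(1, r)] xs = comb_frag l' xs" for r l'
      using comb_chain_bd_eq[of "[(1, r)]" 1 l' c] that c comb_degenerate[of 1 "[(1, r)]"]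
      by (simp add: reduced_comb_iff numeral_2_eq_2)
    have "comb [(1, [0, 1]), (1, [0, 2]), (1, [1, 2]), (-1, [2, 1])] c = 0"
      by (rule 0[of "[0]"]; code_simp)
    moreover have "comb [(-1, [0, 2]), (1, [1, 0]), (1, [1, 2]), (1, [2, 0])] c = 0"
      by (rule 0[of "[1]"]; code_simp)
    moreover have "comb [(1, [0, 1]), (-1, [1, 0]), (1, [2, 0]), (1, [2, 1])] c = 0"
      by (rule 0[of "[2]"]; code_simp)
    \<comment> \<open>With \<open>a\<close>, \<open>b\<close>, \<open>d\<close> for the values of
      the three functionals of \<open>edge_terms\<close> on \<open>c\<close>, the equations read
      \<open>a - d = 0\<close>, \<open>b = 0\<close> and \<open>a + b + d = 0\<close>. Thus
      \<open>2 * a = 0\<close>, and all three vanish because the integers have no torsion.\<close>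
    ultimately have "\<forall>(l, k, t)\<in>set edge_terms. comb l c = 0"
      by (simp add: edge_terms_def comb_def)
    then have "expand edge_terms c = 0"
      by (simp add: expand_def edge_terms_def lin_chain_def)
    moreover obtain d where "d \<in> carrier (chain_grp R3 3)"
      "c - expand edge_terms c - chain_bd R3 d \<in> degenerate R3 2"
      using decomposes_chains[OF decomposes_2 _ c(1)] by (auto simp: eval_nat_numeral)
    ultimately have "d \<in> carrier (chain_grp R3 3)" "K = qchain R3 2 (chain_bd R3 d)"
      using c by (simp_all add: R3.qchain_eq_iff)
    then show "K \<in> boundaries R3 2"
      by (auto simp: R3.boundaries_eq eval_nat_numeral)
  qed
qed simp

section \<open>The four functionals in degree 3\<close>

lemma part_simps [simp]:
  "part i 0 = 0" "part i (a + b) = part i a + part i b" "part i (a - b) = part i a - part i b"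
  "part i (frag_cmul k a) = k * part i a"
  by (simp_all add: part_def)

lemma parts_red: "i < 4 \<Longrightarrow> \<forall>(k, r)\<in>set (parts ! i). r \<in> set (reduced_list 3)"
proof -
  have "\<forall>l\<in>set parts. \<forall>(k, r)\<in>set l. r \<in> set (reduced_list 3)"
    by code_simp
  moreover assume "i < 4"
  then have "parts ! i \<in> set parts"
    by (intro nth_mem) (simp add: parts_def)
  ultimately show ?thesis by blast
qed

lemma reduced_comb_parts: "i < 4 \<Longrightarrow> reduced_comb 3 (parts ! i)"
  by (simp add: reduced_comb_iff parts_red)

lemma part_frag_of: "i < 4 \<Longrightarrow> set xs \<subseteq> carrier R3 \<Longrightarrow> part i (frag_of xs) = comb_frag (parts ! i) xs"
  unfolding part_def by (rule comb_frag_of[OF reduced_comb_parts])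

lemma part_degenerate: "i < 4 \<Longrightarrow> d \<in> degenerate R3 3 \<Longrightarrow> part i d = 0"
  unfolding part_def by (rule comb_degenerate[OF reduced_comb_parts])

lemma comb_append_uminus:
  "comb (l @ map (\<lambda>(k, r). (- k, r)) m) c = comb l c - comb m c"
  by (induction l) (auto simp: comb_def sum_list_case_prod_simps case_prod_beta' o_def uminus_sum_list_map)

text \<open>Three coordinates of the boundary already determine all differences of the four
  functionals. This is read in two ways: on a cycle the functionals agree, and as cochains their
  differences are coboundaries of coordinates.\<close>

lemma part_diff_eq:
  assumes c: "c \<in> carrier (chain_grp R3 3)"
  shows "part 0 c - part 1 c = coord R3 [0, 2] (chain_bd R3 c)"
    and "part 2 c - part 0 c = coord R3 [0, 1] (chain_bd R3 c)"
    and "part 0 c - part 3 c = coord R3 [2, 0] (chain_bd R3 c)"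
proof -
  have *: "part i c - part j c = coord R3 r (chain_bd R3 c)"
    if "r \<in> set (reduced_list 2)" "i < 4" "j < 4" "\<forall>xs\<in>set (reduced_list 3).
      comb_bd [(1, r)] xs = comb_frag (parts ! i @ map (\<lambda>(k, r). (- k, r)) (parts ! j)) xs" for r i j
  proof -
    have "\<forall>(k, r)\<in>set (parts ! i @ map (\<lambda>(k, r). (- k, r)) (parts ! j)). r \<in> set (reduced_list 3)"
      using parts_red[OF that(2)] parts_red[OF that(3)] by auto
    then have "comb [(1, r)] (chain_bd R3 c)
        = comb (parts ! i @ map (\<lambda>(k, r). (- k, r)) (parts ! j)) c"
      using that c by (intro comb_chain_bd_eq[of _ 2]) (simp_all add: eval_nat_numeral)
    then show ?thesis
      by (simp only: comb_append_uminus part_def) (simp add: comb_def)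
  qed
  show "part 0 c - part 1 c = coord R3 [0, 2] (chain_bd R3 c)"
    by (rule *; code_simp)
  show "part 2 c - part 0 c = coord R3 [0, 1] (chain_bd R3 c)"
    by (rule *; code_simp)
  show "part 0 c - part 3 c = coord R3 [2, 0] (chain_bd R3 c)"
    by (rule *; code_simp)
qed

lemma part_cycle:
  assumes c: "c \<in> carrier (chain_grp R3 3)" "chain_bd R3 c \<in> degenerate R3 2" and i: "i < 4"
  shows "part i c = part 0 c"
proof -
  have "coord R3 r (chain_bd R3 c) = 0" if "r \<in> set (reduced_list 2)" for r
    using R3.coord_degenerate[OF c(2)] that by (simp add: reduced_eq_reduced_list)
  moreover have "\<forall>r\<in>{[0, 2], [0, 1], [2, 0]}. r \<in> set (reduced_list 2)"
    by code_simp
  ultimately have "part 1 c = part 0 c" "part 2 c = part 0 c" "part 3 c = part 0 c"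
    using part_diff_eq[OF c(1)] by auto
  moreover have "i = 0 \<or> i = 1 \<or> i = 2 \<or> i = 3"
    using i by linarith
  ultimately show ?thesis by auto
qed

lemma part_0_chain_bd:
  assumes "d \<in> carrier (chain_grp R3 4)"
  shows "part 0 (chain_bd R3 d) = 0"
proof -
  have "\<forall>xs\<in>set (reduced_list 4). comb_bd (parts ! 0) xs = comb_frag [] xs"
    by code_simp
  then have "comb (parts ! 0) (chain_bd R3 d) = comb [] d"
    using assms parts_red[of 0] by (intro comb_chain_bd_eq[of _ 3]) (simp_all add: eval_nat_numeral)
  then show ?thesis
    by (simp add: part_def) (simp add: comb_def)
qed

text \<open>Only \<open>part 0\<close> is evaluated on boundaries of reduced 4-tuples. A boundary is
  a cycle, and on cycles the four functionals agree.\<close>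

lemma part_chain_bd:
  assumes d: "d \<in> carrier (chain_grp R3 4)" and i: "i < 4"
  shows "part i (chain_bd R3 d) = 0"
proof -
  have "chain_bd R3 d \<in> carrier (chain_grp R3 3)"
    using R3.chain_bd_chains[OF _ d] by simp
  then show ?thesis
    using part_cycle[of "chain_bd R3 d" i] i part_0_chain_bd[OF d] R3.chain_bd_twice[OF d] by simp
qed

lemma expand_parts:
  "expand (zip parts cyc_terms) c = frag_cmul (part 1 c) (frag_of [2, 1, 2])
     + frag_cmul (part 3 c) (frag_of [2, 0, 1]) - frag_cmul (part 2 c) (frag_of [1, 0, 2])
     - frag_cmul (part 0 c) (frag_of [0, 2, 1])"
  by (simp add: expand_def lin_chain_def parts_def cyc_terms_def part_def algebra_simps flip: minus_frag_cmul)

lemma chains_3_decomposition: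
  assumes "c \<in> carrier (chain_grp R3 3)"
  obtains d where "d \<in> carrier (chain_grp R3 4)"
    "c - expand (zip parts cyc_terms) c - chain_bd R3 d \<in> degenerate R3 3"
  using decomposes_chains[OF decomposes_3 _ assms] by (auto simp: eval_nat_numeral)

text \<open>On a cycle \<open>part 0\<close> determines the other three, so the whole expansion in
  the four terms vanishes and only a boundary is left modulo degenerate chains.\<close>

lemma part_0_eq_0_boundary:
  assumes c: "c \<in> carrier (chain_grp R3 3)" "chain_bd R3 c \<in> degenerate R3 2" "part 0 c = 0"
  shows "qchain R3 3 c \<in> boundaries R3 3"
proof -
  have "expand (zip parts cyc_terms) c = 0"
    using part_cycle[OF c(1,2)] c(3) by (simp add: expand_parts)
  moreover obtain d where d: "d \<in> carrier (chain_grp R3 4)"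
    "c - expand (zip parts cyc_terms) c - chain_bd R3 d \<in> degenerate R3 3"
    using c(1) by (rule chains_3_decomposition)
  ultimately have "qchain R3 3 c = qchain R3 3 (chain_bd R3 d)"
    by (simp add: R3.qchain_eq_iff)
  then show ?thesis
    using d(1) by (auto simp: R3.boundaries_eq eval_nat_numeral)
qed

section \<open>The cocycles \<open>phi\<close> and \<open>phi'\<close> and the cycle
  \<open>cyc\<close>\<close>

lemma part_hom: "part i \<in> hom (chain_grp R3 3) integer_group"
  by (simp add: hom_def)

lemma is_cocycle_part: "i < 4 \<Longrightarrow> is_cocycle R3 3 (part i)"
  using part_chain_bd[of _ i] by (simp add: R3.is_cocycle_iff part_hom part_degenerate)

lemma A_eq_coord: "A x y z c = coord R3 [x, y, z] c"
  by (simp add: A_def coord_def Let_def)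

lemma phi_eq: "phi = part 0"
  by (simp add: fun_eq_iff phi_def A_eq_coord part_def parts_def comb_def)

lemma phi'_eq: "phi' = (\<lambda>c. part 0 c + part 1 c + part 2 c + part 3 c)"
  by (simp add: fun_eq_iff phi'_def A_eq_coord part_def parts_def comb_def)

lemma is_cocycle_phi': "is_cocycle R3 3 phi'"
proof -
  have "phi' \<in> hom (chain_grp R3 3) integer_group"
    by (simp add: hom_def phi'_eq)
  then show ?thesis
    by (simp add: R3.is_cocycle_iff part_degenerate part_chain_bd phi'_eq)
qed

lemma cyc_chains: "cyc \<in> carrier (chain_grp R3 3)"
proof -
  have "\<forall>(k, xs)\<in>set cyc_terms. xs \<in> tuples R3 3"
    by (simp add: cyc_terms_def tuples_def R3_def)
  then show ?thesis
    unfolding cyc_eq_lin_chain by (rule lin_chain_chains)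
qed

lemma part_cyc: "i < 4 \<Longrightarrow> part i cyc = 1"
proof -
  assume i: "i < 4"
  have "\<forall>l\<in>set parts. comb_frag l [2, 1, 2] + comb_frag l [2, 0, 1] - comb_frag l [1, 0, 2]
      - comb_frag l [0, 2, 1] = 1"
    by code_simp
  moreover have "parts ! i \<in> set parts"
    using i by (intro nth_mem) (simp add: parts_def)
  moreover have "{0, 1, 2} \<subseteq> carrier R3"
    by (simp add: R3_def)
  ultimately show ?thesis
    using i by (simp add: cyc_def part_frag_of)
qed

lemma chain_bd_cyc: "chain_bd R3 cyc \<in> degenerate R3 2"
proof -
  have w: "\<forall>(k, xs)\<in>set cyc_terms. xs \<in> tuples R3 3"
    by (simp add: cyc_terms_def tuples_def R3_def)
  have check: "\<forall>r\<in>set (reduced_list 2). (\<Sum>(k, xs)\<leftarrow>cyc_terms. k * comb_bd [(1, r)] xs) = 0"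
    by code_simp
  have "coord R3 r (chain_bd R3 cyc) = 0" if "r \<in> R3.reduced 2" for r
  proof -
    have "reduced_comb 2 [(1, r)]"
      using that by (simp add: reduced_comb_def)
    from comb_chain_bd_lin_chain[OF this w] check that show ?thesis
      by (simp add: cyc_eq_lin_chain reduced_eq_reduced_list) (simp add: comb_def)
  qed
  moreover have "Poly_Mapping.keys (chain_bd R3 cyc) \<subseteq> words R3 2"
    using R3.chain_bd_chains[OF _ cyc_chains] by (simp add: tuples_eq_words)
  ultimately show ?thesis
    using R3.degenerate_iff_coord by blast
qed

text \<open>All twelve coordinates in degree 3 occur in \<open>phi'\<close> with coefficient 1 or
  -1, and a triple as in the definition lies in the orbit of exactly one reduced word: the action of
  \<open>b\<close> fixes both \<open>b\<close> and \<open>\<rho> b\<close>, so flips never make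
  neighbours equal or opposite. The code evaluates all 216 triples.\<close>

lemma pm_monic_phi': "pm_monic R3 phi'"
proof -
  have check: "\<forall>a\<in>set [0..<6]. \<forall>b\<in>set [0..<6]. \<forall>c\<in>set [0..<6].
      a \<noteq> b \<and> a \<noteq> rho R3 b \<and> c \<noteq> b \<and> c \<noteq> rho R3 b \<longrightarrow>
      \<bar>\<Sum>l\<leftarrow>parts. comb_frag l [a, b, c]\<bar> = 1"
    by code_simp
  have car: "carrier R3 = set [0..<6]"
    by (auto simp: R3_def)
  have parts: "parts = map (\<lambda>i. parts ! i) [0, 1, 2, 3]"
    by (simp add: parts_def)
  have phi': "phi' (frag_of xs) = (\<Sum>l\<leftarrow>parts. comb_frag l xs)" if "set xs \<subseteq> carrier R3" for xs
    by (subst parts) (simp add: phi'_eq part_frag_of that)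
  show ?thesis
    unfolding pm_monic_def
  proof (intro ballI impI)
    fix a b c assume *: "a \<in> carrier R3" "b \<in> carrier R3" "c \<in> carrier R3"
      "a \<notin> {b, rho R3 b} \<and> c \<notin> {b, rho R3 b}"
    then have "\<bar>phi' (frag_of [a, b, c])\<bar> = 1"
      using check by (subst phi') (simp_all add: car)
    then show "phi' (frag_of [a, b, c]) \<in> {1, -1}"
      by auto
  qed
qed

section \<open>Cycles with fewer than four terms\<close>

lemma part_keys:
  assumes "part i c \<noteq> 0"
  obtains t where "t \<in> Poly_Mapping.keys c" "part i (frag_of t) \<noteq> 0"
proof -
  have "part i u = 0" if "\<forall>t\<in>Poly_Mapping.keys c. part i (frag_of t) = 0"
    "Poly_Mapping.keys u \<subseteq> Poly_Mapping.keys c" for u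
    using that(2) by (induction u rule: frag_induction) (use that(1) in auto)
  then show thesis
    using assms that by blast
qed

text \<open>The four functionals use different reduced words, and different reduced words have
  disjoint orbits. It is confirmed by evaluation on all 216 triples for each pair of
  indices.\<close>

lemma part_disjoint:
  assumes "t \<in> tuples R3 3" "i < 4" "j < 4" "part i (frag_of t) \<noteq> 0" "part j (frag_of t) \<noteq> 0"
  shows "i = j"
proof -
  have check: "\<forall>t\<in>set (List.n_lists 3 [0..<6]). \<forall>i\<in>set [0..<4]. \<forall>j\<in>set [0..<i].
      comb_frag (parts ! i) t = 0 \<or> comb_frag (parts ! j) t = 0"
    by code_simp
  have t: "set t \<subseteq> carrier R3" "length t = 3"
    using assms(1) by (auto simp: tuples_def)
  then have "t \<in> set (List.n_lists 3 [0..<6])"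
    by (auto simp: set_n_lists R3_def)
  then have "part i (frag_of t) = 0 \<or> part j (frag_of t) = 0" if "j < i" "i < 4" for i j
    using check[rule_format, of t i j] that t(1) by (simp add: part_frag_of)
  then show ?thesis
    using assms(2-5) linorder_neqE_nat[of i j] by blast
qed

text \<open>On a cycle that is not a boundary all four \<open>part i\<close> are nonzero, and no triple contributes to two
  of them.\<close>

lemma short_cycle_boundary:
  assumes c: "c \<in> carrier (chain_grp R3 3)" "chain_bd R3 c \<in> degenerate R3 2"
    and short: "card (Poly_Mapping.keys c) < 4"
  shows "qchain R3 3 c \<in> boundaries R3 3"
proof (rule part_0_eq_0_boundary[OF c], rule ccontr)
  assume "part 0 c \<noteq> 0"
  then have "\<exists>t. t \<in> Poly_Mapping.keys c \<and> part i (frag_of t) \<noteq> 0" if "i < 4" for i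
    using part_cycle[OF c that] part_keys[of i c] by metis
  then obtain t where t: "\<And>i. i < 4 \<Longrightarrow> t i \<in> Poly_Mapping.keys c"
    "\<And>i. i < 4 \<Longrightarrow> part i (frag_of (t i)) \<noteq> 0"
    by metis
  have "inj_on t {..<4}"
  proof (rule inj_onI)
    fix i j assume ij: "i \<in> {..<4}" "j \<in> {..<4}" "t i = t j"
    then have "t i \<in> tuples R3 3"
      using t(1)[of i] c(1) by auto
    then show "i = j"
      using part_disjoint[of "t i" i j] t(2)[of i] t(2)[of j] ij by simp
  qed
  then have "card (t ` {..<4}) = 4"
    by (simp add: card_image)
  moreover have "card (t ` {..<4}) \<le> card (Poly_Mapping.keys c)"
    using t(1) by (intro card_mono) auto
  ultimately show False
    using short by simp
qed

section \<open>Cocycles that vanish on the generating cycle\<close>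

lemma (in symmetric_quandle) cochain_cmul:
  assumes f: "f \<in> carrier (cochain_grp Q n)" and c: "c \<in> chains n"
  shows "f (qchain Q n (frag_cmul k c)) = k * f (qchain Q n c)"
proof -
  have k: "frag_cmul k c \<in> chains n" for k
    using c by (auto intro: order.trans[OF keys_cmul])
  show ?thesis
  proof (induction k rule: int_induct[of _ 0])
    case base
    then show ?case by (simp add: cochain_0[OF f])
  next
    case (step1 k)
    then show ?case
      using cochain_add[OF f k[of k] c] by (simp add: frag_cmul_distrib algebra_simps)
  next
    case (step2 k)
    then show ?case
      using cochain_diff[OF f k[of k] c] by (simp add: frag_cmul_diff_distrib algebra_simps)
  qed
qed

text \<open>A cocycle \<open>f\<close> is determined by its values on the four terms of \<open>cyc\<close>. When they sum to \<open>0\<close>,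
  \<open>f\<close> is a combination of the differences \<open>part i - part 0\<close>, and these are the coboundaries of
  coordinates.\<close>

lemma cocycle_coboundary:
  assumes f: "f \<in> cocycles R3 3" and cyc: "f (qchain R3 3 cyc) = 0"
  shows "f \<in> coboundaries R3 3"
proof -
  have fc: "f \<in> carrier (cochain_grp R3 3)"
    and bd: "\<And>d. d \<in> carrier (chain_grp R3 4) \<Longrightarrow> f (qchain R3 3 (chain_bd R3 d)) = 0"
    using f by (simp_all add: R3.mem_cocycles_iff)
  define v where "v t = f (qchain R3 3 (frag_of t))" for t
  have t: "frag_of t \<in> carrier (chain_grp R3 3)" if "t \<in> {[2, 1, 2], [2, 0, 1], [1, 0, 2], [0, 2, 1]}" for t
    using that by (auto simp: tuples_def R3_def)
  have cmul: "frag_cmul k (frag_of t) \<in> carrier (chain_grp R3 3)"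
    "f (qchain R3 3 (frag_cmul k (frag_of t))) = k * v t"
    if "t \<in> {[2, 1, 2], [2, 0, 1], [1, 0, 2], [0, 2, 1]}" for t k
    using t[OF that] R3.cochain_cmul[OF fc] by (auto simp: v_def intro: order.trans[OF keys_cmul])
  have lin: "f (qchain R3 3 (frag_cmul a (frag_of [2, 1, 2]) + frag_cmul b (frag_of [2, 0, 1])
      - frag_cmul p (frag_of [1, 0, 2]) - frag_cmul q (frag_of [0, 2, 1])))
    = a * v [2, 1, 2] + b * v [2, 0, 1] - p * v [1, 0, 2] - q * v [0, 2, 1]" for a b p q
    by (simp add: R3.cochain_diff[OF fc] R3.cochain_add[OF fc] R3.chains_diff R3.chains_add cmul
        del: carrier_chain_grp)
  have v: "v [2, 1, 2] + v [2, 0, 1] - v [1, 0, 2] - v [0, 2, 1] = 0"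
    using lin[of 1 1 1 1] cyc by (simp add: cyc_def)
  \<comment> \<open>By the decomposition of chains, \<open>f\<close> is \<open>v [2, 1, 2]\<close>
    times \<open>part 1\<close>, plus \<open>v [2, 0, 1]\<close> times \<open>part 3\<close>, minus
    \<open>v [1, 0, 2]\<close> times \<open>part 2\<close>, minus \<open>v [0, 2, 1]\<close> times
    \<open>part 0\<close>. The relation \<open>v\<close> eliminates the last coefficient and leaves
    differences with \<open>part 0\<close>; \<open>part_diff_eq\<close> writes these as coboundaries
    of coordinates, whose coefficients form \<open>l\<close>.\<close>
  define l where "l = [(- v [2, 1, 2], [0, 2]), (- v [1, 0, 2], [0, 1]), (- v [2, 0, 1], [2, 0 :: nat])]"
  have red: "reduced_comb 2 l"
  proof -
    have "\<forall>r\<in>{[0, 2], [0, 1], [2, 0]}. r \<in> set (reduced_list 2)"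
      by code_simp
    then show ?thesis by (simp add: l_def reduced_comb_iff)
  qed
  have hom: "comb l \<in> hom (chain_grp R3 2) integer_group"
    by (simp add: hom_def)
  have deg: "\<forall>d\<in>degenerate R3 2. comb l d = 0"
    using comb_degenerate[OF red] by blast
  let ?g = "induced_cochain R3 2 (comb l)"
  have g: "?g \<in> carrier (cochain_grp R3 2)"
    by (rule R3.induced_cochain_in_carrier[OF hom deg])
  have "f = cobd R3 3 ?g"
  proof (rule R3.cochain_eqI[OF fc])
    show "cobd R3 3 ?g \<in> carrier (cochain_grp R3 3)"
      using R3.cobd_in_carrier[OF _ g] by (simp add: eval_nat_numeral)
    fix c assume c: "c \<in> carrier (chain_grp R3 3)"
    obtain d where d: "d \<in> carrier (chain_grp R3 4)"
      "c - expand (zip parts cyc_terms) c - chain_bd R3 d \<in> degenerate R3 3"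
      using c by (rule chains_3_decomposition)
    let ?e = "expand (zip parts cyc_terms) c"
    have e: "?e \<in> carrier (chain_grp R3 3)"
      unfolding expand_parts by (intro R3.chains_diff R3.chains_add cmul) simp_all
    have bdc: "chain_bd R3 d \<in> carrier (chain_grp R3 3)" "chain_bd R3 c \<in> carrier (chain_grp R3 2)"
      using R3.chain_bd_chains[OF _ d(1)] R3.chain_bd_chains[OF _ c] by simp_all
    have "qchain R3 3 c = qchain R3 3 (?e + chain_bd R3 d)"
      using d(2) by (simp add: R3.qchain_eq_iff algebra_simps)
    then have "f (qchain R3 3 c) = f (qchain R3 3 ?e)"
      using R3.cochain_add[OF fc e bdc(1)] bd[OF d(1)] by simp
    also have "\<dots> = part 1 c * v [2, 1, 2] + part 3 c * v [2, 0, 1] - part 2 c * v [1, 0, 2]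
        - part 0 c * v [0, 2, 1]"
      unfolding expand_parts by (rule lin)
    \<comment> \<open>The last summand on the right is zero by \<open>v\<close>; it is added so that
      the other terms regroup into differences.\<close>
    also have "\<dots> = - v [2, 1, 2] * (part 0 c - part 1 c) - v [1, 0, 2] * (part 2 c - part 0 c)
        - v [2, 0, 1] * (part 0 c - part 3 c)
        + part 0 c * (v [2, 1, 2] + v [2, 0, 1] - v [1, 0, 2] - v [0, 2, 1])"
      by (simp add: algebra_simps)
    also have "\<dots> = comb l (chain_bd R3 c)"
      unfolding v part_diff_eq[OF c] by (simp add: l_def comb_def)
    also have "\<dots> = cobd R3 3 ?g (qchain R3 3 c)"
      using R3.cobd_qchain[of 2 c ?g] c R3.induced_cochain_qchain[OF hom deg bdc(2)]
      by (simp add: eval_nat_numeral)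
    finally show "f (qchain R3 3 c) = cobd R3 3 ?g (qchain R3 3 c)" .
  qed
  then show ?thesis
    using g by (auto simp: coboundaries_def)
qed

theorem lemma4p1:
  shows
    "(\<comment> \<open>(i)\<close>
      trivial_group (homology_grp R3 2) \<and> homology_grp R3 3 \<cong> integer_group) \<and>
     (\<comment> \<open>(ii)\<close>
      qchain R3 3 cyc \<in> cycles R3 3 \<and>
      carrier (homology_grp R3 3)
        = generate (homology_grp R3 3) {homology_class R3 3 (qchain R3 3 cyc)}) \<and>
     (\<comment> \<open>(iii)\<close>
      \<forall>c\<in>carrier (chain_grp R3 3).
        qchain R3 3 c \<in> cycles R3 3 \<and> card (Poly_Mapping.keys c) < 4
          \<longrightarrow> qchain R3 3 c \<in> boundaries R3 3) \<and>
     (\<comment> \<open>(iv)\<close>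
      is_cocycle R3 3 phi \<and>
      cohomology_grp R3 3 \<cong> integer_group \<and>
      carrier (cohomology_grp R3 3)
        = generate (cohomology_grp R3 3) {cohomology_class R3 3 (induced_cochain R3 3 phi)} \<and>
      eval_class (induced_cochain R3 3 phi) (homology_class R3 3 (qchain R3 3 cyc)) = 1) \<and>
     (\<comment> \<open>(v)\<close>
      is_cocycle R3 3 phi' \<and>
      pm_monic R3 phi' \<and>
      eval_class (induced_cochain R3 3 phi') (homology_class R3 3 (qchain R3 3 cyc)) = 4)"
proof -
  have phi: "is_cocycle R3 3 phi" and phi_cyc: "phi cyc = 1"
    using is_cocycle_part[of 0] part_cyc[of 0] by (simp_all add: phi_eq)
  have bd: "chain_bd R3 cyc \<in> degenerate R3 (3 - 1)"
    using chain_bd_cyc by simp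
  have eval: "eval_class (induced_cochain R3 3 \<theta>) (homology_class R3 3 (qchain R3 3 cyc)) = \<theta> cyc"
    if "is_cocycle R3 3 \<theta>" for \<theta>
    using that cyc_chains
    by (simp add: is_cocycle_def R3.eval_homology_class R3.induced_cochain_qchain del: carrier_chain_grp)
  have "qchain R3 3 c \<in> boundaries R3 3"
    if "c \<in> carrier (chain_grp R3 3)" "chain_bd R3 c \<in> degenerate R3 (3 - 1)" "phi c = 0" for c
    using that part_0_eq_0_boundary by (simp add: phi_eq)
  note homology = R3.homology_infinite_cyclic[OF _ phi cyc_chains bd phi_cyc this]
  note cohomology = R3.cohomology_infinite_cyclic[OF _ phi cyc_chains bd phi_cyc cocycle_coboundary]
  have phi'_cyc: "phi' cyc = 4"
    by (simp add: phi'_eq part_cyc)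
  have cycle: "qchain R3 3 c \<in> cycles R3 3 \<longleftrightarrow> chain_bd R3 c \<in> degenerate R3 2"
    if "c \<in> carrier (chain_grp R3 3)" for c
    using R3.qchain_mem_cycles_iff[OF _ that] by simp
  show ?thesis
  proof (intro conjI ballI impI)
    show "qchain R3 3 cyc \<in> cycles R3 3"
      using cycle[OF cyc_chains] chain_bd_cyc by simp
  next
    fix c assume "c \<in> carrier (chain_grp R3 3)"
      and "qchain R3 3 c \<in> cycles R3 3 \<and> card (Poly_Mapping.keys c) < 4"
    then show "qchain R3 3 c \<in> boundaries R3 3"
      using short_cycle_boundary cycle by blast
  next
    show "eval_class (induced_cochain R3 3 phi) (homology_class R3 3 (qchain R3 3 cyc)) = 1"
      using eval[OF phi] phi_cyc by simp
    show "eval_class (induced_cochain R3 3 phi') (homology_class R3 3 (qchain R3 3 cyc)) = 4"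
      using eval[OF is_cocycle_phi'] phi'_cyc by simp
  qed (rule trivial_homology_2 homology cohomology phi is_cocycle_phi' pm_monic_phi'; simp)+
qed

end
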